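(* Fix $p\ge1$. For each $n$ let $B_n$ be an $n\times p$ random matrix whose entries belong to the first Wiener chaos $\mathcal{W}_1$ (i.e. are centered jointly Gaussian variables in the closed linear span of the $N_i$), and let $A_n={}^tB_nB_n$. Assume that $A_n$ converges in probability to a deterministic invertible matrix $\Sigma$. Then for every $q\ge1$ there exist $N\in\mathbb{N}$ and $C>0$ such that $\mathbb{E}[\det(A_n)^{-q}]\le C$ for all $n\ge N$. In particular $A_n^{-1}\to\Sigma^{-1}$ in $L^q$ for every $q\ge1$.
   Context: $(N_i)_{i\ge1}$ is an i.i.d. standard Gaussian sequence; $\mathcal{W}_1$ is its first Wiener chaos, the $L^2$-closure of the linear span of the $N_i$. *)

theory Defs
  imports "HOL-Analysis.Analysis" "HOL-Probability.Probability"
begin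

definition first_wiener_chaos :: "'a measure \<Rightarrow> (nat \<Rightarrow> 'a \<Rightarrow> real) \<Rightarrow> ('a \<Rightarrow> real) set" where
  "first_wiener_chaos M N =
     {X. X \<in> borel_measurable M \<and> integrable M (\<lambda>\<omega>. (X \<omega>)\<^sup>2) \<and>
         (\<exists>m :: nat \<Rightarrow> nat. \<exists>c :: nat \<Rightarrow> nat \<Rightarrow> real.
            (\<lambda>k. \<integral>\<^sup>+\<omega>. ennreal ((X \<omega> - (\<Sum>i<m k. c k i * N i \<omega>))\<^sup>2) \<partial>M) \<longlonglongrightarrow> 0)}"

definition gram_matrix :: "nat \<Rightarrow> (nat \<Rightarrow> 'p \<Rightarrow> real) \<Rightarrow> real^'p^'p" where
  "gram_matrix n B = (\<chi> j k. \<Sum>i<n. B i j * B i k)"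

end

theory Submission
  imports Defs "HOL-Real_Asymp.Real_Asymp"
begin

text \<open>
  Let \<open>Q = \<Sum> Y\<^sub>i\<^sup>2\<close> for variables \<open>Y\<^sub>i\<close> of the first chaos, with covariance matrix \<open>\<Gamma>\<close> of Hilbert-Schmidt
  norm \<open>h\<close>. Gaussian integration by parts applied to \<open>Y\<^sub>i (\<delta> + Q)\<^bsup>-m-1\<^esup>\<close> gives
  \<open>(E Q - 2 (m + 1) h) E (\<delta> + Q)\<^bsup>-m-1\<^esup> \<le> E (\<delta> + Q)\<^bsup>-m\<^esup>\<close>. As \<open>Var Q = 2 h\<^sup>2\<close>, concentration of \<open>Q\<close> around
  its mean makes \<open>h\<close> small compared to \<open>E Q\<close>, and iteration bounds as many negative moments of \<open>Q\<close>
  as desired. Equivalence of Gaussian moments upgrades the convergence in probability of the Gram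
  matrices \<open>A\<^sub>n\<close> to convergence of all moments, so this applies to \<open>Q = x \<bullet> A\<^sub>n x\<close> uniformly in
  \<open>1 \<le> |x| \<le> 2\<close> for large \<open>n\<close>. Finally, if the minimum \<open>\<mu>\<close> of \<open>v \<bullet> A v\<close> over the unit sphere is small, then
  \<open>x \<bullet> A x\<close> is small on a whole ball inside this shell; hence the integral of \<open>(x \<bullet> A x)\<^bsup>-m\<^esup>\<close> over the shell
  controls negative powers of \<open>\<mu>\<close>, which in turn control \<open>1 / det A\<close> and the inverse matrix.
\<close>

section \<open>Square-integrable functions\<close>

definition square_integrable :: "'a measure \<Rightarrow> ('a \<Rightarrow> real) \<Rightarrow> bool" where
  "square_integrable M f \<longleftrightarrow> f \<in> borel_measurable M \<and> integrable M (\<lambda>x. (f x)\<^sup>2)"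

definition L2_norm :: "'a measure \<Rightarrow> ('a \<Rightarrow> real) \<Rightarrow> real" where
  "L2_norm M f = sqrt (\<integral>x. (f x)\<^sup>2 \<partial>M)"

lemma square_integrable_measurable [measurable_dest]:
  "square_integrable M f \<Longrightarrow> f \<in> borel_measurable M"
  by (simp add: square_integrable_def)

lemma square_integrable_imp_integrable_square:
  "square_integrable M f \<Longrightarrow> integrable M (\<lambda>x. (f x)\<^sup>2)"
  by (simp add: square_integrable_def)

lemma (in finite_measure) integrable_of_square_integrable:
  "square_integrable M f \<Longrightarrow> integrable M f"
  by (simp add: square_integrable_def square_integrable_imp_integrable)

lemma square_integrable_imp_integrable_mult:
  assumes f: "square_integrable M f" and g: "square_integrable M g"
  shows "integrable M (\<lambda>x. f x * g x)"
proof (rule Bochner_Integration.integrable_bound)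
  show "integrable M (\<lambda>x. (f x)\<^sup>2 + (g x)\<^sup>2)"
    using f g by (simp add: square_integrable_def)
  have "\<bar>a * b\<bar> \<le> a\<^sup>2 + b\<^sup>2" for a b :: real
    using sum_squares_bound[of "\<bar>a\<bar>" "\<bar>b\<bar>"] abs_ge_zero[of "a * b"]
    by (simp only: abs_mult power2_abs)
  then show "AE x in M. norm (f x * g x) \<le> norm ((f x)\<^sup>2 + (g x)\<^sup>2)"
    by (simp add: abs_of_nonneg)
qed (use f g in measurable)

lemma square_integrable_zero: "square_integrable M (\<lambda>_. 0)"
  by (simp add: square_integrable_def)

lemma square_integrable_scale:
  "square_integrable M f \<Longrightarrow> square_integrable M (\<lambda>x. c * f x)"
  by (auto simp: square_integrable_def power_mult_distrib)

lemma square_integrable_add: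
  assumes f: "square_integrable M f" and g: "square_integrable M g"
  shows "square_integrable M (\<lambda>x. f x + g x)"
  using f g square_integrable_imp_integrable_mult[OF f g]
  by (auto simp: square_integrable_def power2_sum mult.assoc)

lemma square_integrable_diff:
  assumes "square_integrable M f" "square_integrable M g"
  shows "square_integrable M (\<lambda>x. f x - g x)"
  using square_integrable_add[OF assms(1) square_integrable_scale[OF assms(2), of "- 1"]] by simp

lemma square_integrable_sum:
  assumes "\<And>i. i \<in> I \<Longrightarrow> square_integrable M (f i)"
  shows "square_integrable M (\<lambda>x. \<Sum>i\<in>I. f i x)"
  using assms
  by (induction I rule: infinite_finite_induct)
    (auto intro: square_integrable_zero square_integrable_add)

lemma Cauchy_Schwarz_integral:
  assumes f: "square_integrable M f" and g: "square_integrable M g"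
  shows "(\<integral>x. \<bar>f x * g x\<bar> \<partial>M) \<le> L2_norm M f * L2_norm M g"
proof -
  note [measurable] = square_integrable_measurable[OF f] square_integrable_measurable[OF g]
  have square: "(\<integral>\<^sup>+x. (ennreal \<bar>h x\<bar>)\<^sup>2 \<partial>M) = ennreal (\<integral>x. (h x)\<^sup>2 \<partial>M)"
    if "square_integrable M h" for h
    using nn_integral_eq_integral[OF square_integrable_imp_integrable_square[OF that]]
    by (simp add: ennreal_power)
  have "ennreal ((\<integral>x. \<bar>f x * g x\<bar> \<partial>M)\<^sup>2) = (\<integral>\<^sup>+x. ennreal \<bar>f x\<bar> * ennreal \<bar>g x\<bar> \<partial>M)\<^sup>2"
    using nn_integral_eq_integral[OF integrable_abs[OF square_integrable_imp_integrable_mult[OF f g]]]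
    by (simp add: ennreal_power[symmetric] ennreal_mult'[symmetric] abs_mult)
  also have "\<dots> \<le> ennreal ((\<integral>x. (f x)\<^sup>2 \<partial>M) * (\<integral>x. (g x)\<^sup>2 \<partial>M))"
    using Cauchy_Schwarz_nn_integral[of "\<lambda>x. ennreal \<bar>f x\<bar>" M "\<lambda>x. ennreal \<bar>g x\<bar>"]
    by (simp add: square f g ennreal_mult)
  finally have "(\<integral>x. \<bar>f x * g x\<bar> \<partial>M)\<^sup>2 \<le> (\<integral>x. (f x)\<^sup>2 \<partial>M) * (\<integral>x. (g x)\<^sup>2 \<partial>M)"
    by (simp add: ennreal_le_iff)
  then show ?thesis
    unfolding L2_norm_def real_sqrt_mult[symmetric] by (rule real_le_rsqrt)
qed

lemma L2_norm_power2: "(L2_norm M f)\<^sup>2 = (\<integral>x. (f x)\<^sup>2 \<partial>M)"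
  by (simp add: L2_norm_def)

lemma L2_norm_nonneg: "0 \<le> L2_norm M f"
  by (simp add: L2_norm_def)

lemma L2_norm_scale: "L2_norm M (\<lambda>x. c * f x) = \<bar>c\<bar> * L2_norm M f"
  by (simp add: L2_norm_def power_mult_distrib real_sqrt_mult)

lemma abs_integral_mult_le_L2_norm:
  assumes "square_integrable M f" "square_integrable M g"
  shows "\<bar>\<integral>x. f x * g x \<partial>M\<bar> \<le> L2_norm M f * L2_norm M g"
  using integral_abs_bound[of M "\<lambda>x. f x * g x"] Cauchy_Schwarz_integral[OF assms] by linarith

lemma L2_norm_triangle:
  assumes f: "square_integrable M f" and g: "square_integrable M g"
  shows "L2_norm M (\<lambda>x. f x + g x) \<le> L2_norm M f + L2_norm M g"
proof (rule power2_le_imp_le)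
  have "(L2_norm M (\<lambda>x. f x + g x))\<^sup>2 = (L2_norm M f)\<^sup>2 + (L2_norm M g)\<^sup>2 + 2 * (\<integral>x. f x * g x \<partial>M)"
    using f g square_integrable_imp_integrable_mult[OF f g]
    by (simp add: L2_norm_power2 power2_sum square_integrable_def mult.assoc)
  then show "(L2_norm M (\<lambda>x. f x + g x))\<^sup>2 \<le> (L2_norm M f + L2_norm M g)\<^sup>2"
    using abs_integral_mult_le_L2_norm[OF f g] by (simp add: power2_sum)
qed (simp add: L2_norm_nonneg)

definition tendsto_L2 :: "'a measure \<Rightarrow> (nat \<Rightarrow> 'a \<Rightarrow> real) \<Rightarrow> ('a \<Rightarrow> real) \<Rightarrow> bool" where
  "tendsto_L2 M F f \<longleftrightarrow> (\<lambda>k. L2_norm M (\<lambda>x. F k x - f x)) \<longlonglongrightarrow> 0"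

lemma tendsto_L2_const: "tendsto_L2 M (\<lambda>_. f) f"
  by (simp add: tendsto_L2_def L2_norm_def)

lemma tendsto_L2_scale:
  assumes "tendsto_L2 M F f"
  shows "tendsto_L2 M (\<lambda>k x. c * F k x) (\<lambda>x. c * f x)"
  using tendsto_mult_right_zero[OF assms[unfolded tendsto_L2_def], of "\<bar>c\<bar>"]
  by (simp add: tendsto_L2_def right_diff_distrib[symmetric] L2_norm_scale)

lemma tendsto_L2_add:
  assumes F: "tendsto_L2 M F f" "\<And>k. square_integrable M (F k)" "square_integrable M f"
    and G: "tendsto_L2 M G g" "\<And>k. square_integrable M (G k)" "square_integrable M g"
  shows "tendsto_L2 M (\<lambda>k x. F k x + G k x) (\<lambda>x. f x + g x)"
  unfolding tendsto_L2_def
proof (rule Lim_null_comparison)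
  have "L2_norm M (\<lambda>x. F k x + G k x - (f x + g x))
      \<le> L2_norm M (\<lambda>x. F k x - f x) + L2_norm M (\<lambda>x. G k x - g x)" for k
    using L2_norm_triangle[OF square_integrable_diff[OF F(2,3)] square_integrable_diff[OF G(2,3)]]
    by (simp add: algebra_simps)
  then show "\<forall>\<^sub>F k in sequentially. norm (L2_norm M (\<lambda>x. F k x + G k x - (f x + g x)))
      \<le> L2_norm M (\<lambda>x. F k x - f x) + L2_norm M (\<lambda>x. G k x - g x)"
    by (simp add: L2_norm_nonneg)
  show "(\<lambda>k. L2_norm M (\<lambda>x. F k x - f x) + L2_norm M (\<lambda>x. G k x - g x)) \<longlonglongrightarrow> 0"
    using tendsto_add[OF F(1)[unfolded tendsto_L2_def] G(1)[unfolded tendsto_L2_def]] by simp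
qed

lemma tendsto_L2_integral_mult:
  assumes F: "tendsto_L2 M F f" "\<And>k. square_integrable M (F k)" "square_integrable M f"
    and G: "tendsto_L2 M G g" "\<And>k. square_integrable M (G k)" "square_integrable M g"
  shows "(\<lambda>k. \<integral>x. F k x * G k x \<partial>M) \<longlonglongrightarrow> (\<integral>x. f x * g x \<partial>M)"
proof (rule LIM_zero_cancel, rule Lim_null_comparison)
  let ?dF = "\<lambda>k x. F k x - f x" and ?dG = "\<lambda>k x. G k x - g x"
  have dF: "square_integrable M (?dF k)" and dG: "square_integrable M (?dG k)" for k
    by (intro square_integrable_diff F G)+
  have "\<bar>(\<integral>x. F k x * G k x \<partial>M) - (\<integral>x. f x * g x \<partial>M)\<bar>
      \<le> L2_norm M (?dF k) * L2_norm M (?dG k) + L2_norm M (?dF k) * L2_norm M g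
        + L2_norm M f * L2_norm M (?dG k)" for k
  proof -
    have "(\<integral>x. F k x * G k x \<partial>M) - (\<integral>x. f x * g x \<partial>M) = (\<integral>x. F k x * G k x - f x * g x \<partial>M)"
      by (intro Bochner_Integration.integral_diff[symmetric] square_integrable_imp_integrable_mult F G)
    also have "\<dots> = (\<integral>x. ?dF k x * ?dG k x + ?dF k x * g x + f x * ?dG k x \<partial>M)"
      by (simp add: algebra_simps)
    also have "\<dots> = (\<integral>x. ?dF k x * ?dG k x \<partial>M) + (\<integral>x. ?dF k x * g x \<partial>M) + (\<integral>x. f x * ?dG k x \<partial>M)"
      using square_integrable_imp_integrable_mult[OF dF dG]
        square_integrable_imp_integrable_mult[OF dF G(3)]
        square_integrable_imp_integrable_mult[OF F(3) dG]
      by (simp only: Bochner_Integration.integral_add Bochner_Integration.integrable_add)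
    finally show ?thesis
      using abs_integral_mult_le_L2_norm[OF dF[of k] dG[of k]]
        abs_integral_mult_le_L2_norm[OF dF[of k] G(3)]
        abs_integral_mult_le_L2_norm[OF F(3) dG[of k]] by linarith
  qed
  then show "\<forall>\<^sub>F k in sequentially. norm ((\<integral>x. F k x * G k x \<partial>M) - (\<integral>x. f x * g x \<partial>M))
      \<le> L2_norm M (?dF k) * L2_norm M (?dG k) + L2_norm M (?dF k) * L2_norm M g
        + L2_norm M f * L2_norm M (?dG k)"
    by simp
  show "(\<lambda>k. L2_norm M (?dF k) * L2_norm M (?dG k) + L2_norm M (?dF k) * L2_norm M g
        + L2_norm M f * L2_norm M (?dG k)) \<longlonglongrightarrow> 0"
    using F(1) G(1) unfolding tendsto_L2_def
    by (intro tendsto_add_zero tendsto_mult_zero tendsto_mult_left_zero tendsto_mult_right_zero)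
qed

lemma tendsto_L2_AE_subseq:
  fixes F :: "'i \<Rightarrow> nat \<Rightarrow> 'a \<Rightarrow> real"
  assumes I: "finite I"
    and F: "\<And>i. i \<in> I \<Longrightarrow> tendsto_L2 M (F i) (f i)"
      "\<And>i k. i \<in> I \<Longrightarrow> square_integrable M (F i k)" "\<And>i. i \<in> I \<Longrightarrow> square_integrable M (f i)"
  obtains r :: "nat \<Rightarrow> nat"
    where "strict_mono r" "AE x in M. \<forall>i\<in>I. (\<lambda>k. F i (r k) x) \<longlonglongrightarrow> f i x"
proof -
  let ?u = "\<lambda>k x. \<Sum>i\<in>I. (F i k x - f i x)\<^sup>2"
  have integrable: "integrable M (\<lambda>x. (F i k x - f i x)\<^sup>2)" if "i \<in> I" for i k
    using that by (intro square_integrable_imp_integrable_square square_integrable_diff F)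
  have "(\<lambda>k. \<Sum>i\<in>I. (L2_norm M (\<lambda>x. F i k x - f i x))\<^sup>2) \<longlonglongrightarrow> (\<Sum>i\<in>I. 0\<^sup>2)"
    by (intro tendsto_sum tendsto_power F(1)[unfolded tendsto_L2_def])
  then have "(\<lambda>k. \<integral>x. norm (?u k x) \<partial>M) \<longlonglongrightarrow> 0"
    using integrable by (simp add: L2_norm_power2 abs_of_nonneg sum_nonneg)
  then obtain r where r: "strict_mono r" and u: "AE x in M. (\<lambda>k. ?u (r k) x) \<longlonglongrightarrow> 0"
    using tendsto_L1_AE_subseq[of M ?u] integrable by auto
  have "\<forall>i\<in>I. (\<lambda>k. F i (r k) x) \<longlonglongrightarrow> f i x" if u: "(\<lambda>k. ?u (r k) x) \<longlonglongrightarrow> 0" for x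
  proof
    fix i assume i: "i \<in> I"
    have "(F i (r k) x - f i x)\<^sup>2 \<le> ?u (r k) x" for k
      using I i by (intro member_le_sum) auto
    then have "(\<lambda>k. (F i (r k) x - f i x)\<^sup>2) \<longlonglongrightarrow> 0"
      by (intro Lim_null_comparison[OF _ u]) simp
    then show "(\<lambda>k. F i (r k) x) \<longlonglongrightarrow> f i x"
      by (simp add: LIM_zero_iff)
  qed
  then have "AE x in M. \<forall>i\<in>I. (\<lambda>k. F i (r k) x) \<longlonglongrightarrow> f i x"
    using u by (auto elim: eventually_mono)
  with r show thesis by (rule that)
qed

section \<open>Convergence in probability\<close>

context prob_space
begin

definition tendsto_zero_in_prob :: "(nat \<Rightarrow> 'a \<Rightarrow> real) \<Rightarrow> bool" where
  "tendsto_zero_in_prob f \<longleftrightarrow>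
     (\<forall>\<epsilon>>0. (\<lambda>n. prob {\<omega> \<in> space M. \<epsilon> < \<bar>f n \<omega>\<bar>}) \<longlonglongrightarrow> 0)"

lemma tendsto_zero_in_probD:
  assumes "tendsto_zero_in_prob f" "0 < \<epsilon>" "0 < \<eta>"
  shows "\<forall>\<^sub>F n in sequentially. prob {\<omega> \<in> space M. \<epsilon> < \<bar>f n \<omega>\<bar>} < \<eta>"
  using assms by (auto simp: tendsto_zero_in_prob_def intro: order_tendstoD)

lemma square_integrable_const: "square_integrable M (\<lambda>_. c)"
  by (simp add: square_integrable_def)

lemma expectation_abs_le_truncation:
  assumes f: "square_integrable M f" and \<epsilon>: "0 \<le> \<epsilon>"
  shows "expectation (\<lambda>\<omega>. \<bar>f \<omega>\<bar>)
      \<le> \<epsilon> + L2_norm M f * sqrt (prob {\<omega> \<in> space M. \<epsilon> < \<bar>f \<omega>\<bar>})"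
proof -
  define E where "E = {\<omega> \<in> space M. \<epsilon> < \<bar>f \<omega>\<bar>}"
  note [measurable] = square_integrable_measurable[OF f]
  have E [measurable]: "E \<in> sets M"
    unfolding E_def by measurable
  have "square_integrable M (indicator E :: 'a \<Rightarrow> real)"
    by (auto simp: square_integrable_def power2_eq_square indicator_inter_arith[symmetric]
        less_top[symmetric])
  note indicator = this square_integrable_imp_integrable_mult[OF f this]
  have "expectation (\<lambda>\<omega>. \<bar>f \<omega>\<bar>) \<le> expectation (\<lambda>\<omega>. \<epsilon> + \<bar>f \<omega> * indicator E \<omega>\<bar>)"
    using integrable_of_square_integrable[OF f] indicator(2) \<epsilon>
    by (intro integral_mono) (auto simp: E_def indicator_def)
  also have "\<dots> = \<epsilon> + expectation (\<lambda>\<omega>. \<bar>f \<omega> * indicator E \<omega>\<bar>)"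
    using indicator(2) by (simp add: prob_space)
  also have "\<dots> \<le> \<epsilon> + L2_norm M f * L2_norm M (indicator E)"
    using Cauchy_Schwarz_integral[OF f indicator(1)] by simp
  also have "L2_norm M (indicator E) = sqrt (prob E)"
    by (simp add: L2_norm_def power2_eq_square indicator_inter_arith[symmetric])
  finally show ?thesis
    by (simp add: E_def)
qed

lemma paley_zygmund:
  assumes R: "square_integrable M R" "\<And>\<omega>. 0 \<le> R \<omega>" and \<theta>: "0 \<le> \<theta>" "\<theta> \<le> 1"
  shows "(1 - \<theta>)\<^sup>2 * (expectation R)\<^sup>2
      \<le> expectation (\<lambda>\<omega>. (R \<omega>)\<^sup>2) * prob {\<omega> \<in> space M. \<theta> * expectation R < R \<omega>}"
proof -
  let ?P = "prob {\<omega> \<in> space M. \<theta> * expectation R < R \<omega>}"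
  have nonneg: "0 \<le> expectation R"
    using R(2) by simp
  then have "(1 - \<theta>) * expectation R \<le> L2_norm M R * sqrt ?P"
    using expectation_abs_le_truncation[OF R(1), of "\<theta> * expectation R"] R(2) \<theta>(1)
    by (simp add: algebra_simps)
  then have "((1 - \<theta>) * expectation R)\<^sup>2 \<le> (L2_norm M R * sqrt ?P)\<^sup>2"
    using nonneg \<theta>(2) by (intro power_mono) auto
  then show ?thesis
    by (simp add: power_mult_distrib L2_norm_power2)
qed

lemma expectation_le_of_small_tail:
  assumes R: "square_integrable M R" "\<And>\<omega>. 0 \<le> R \<omega>"
    and second_moment: "expectation (\<lambda>\<omega>. (R \<omega>)\<^sup>2) \<le> \<kappa> * (expectation R)\<^sup>2"
    and tail: "\<kappa> * prob {\<omega> \<in> space M. K / 2 < R \<omega>} < 1 / 4" and K: "0 \<le> K"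
  shows "expectation R \<le> K"
proof (rule ccontr)
  assume large: "\<not> expectation R \<le> K"
  note [measurable] = square_integrable_measurable[OF R(1)]
  let ?P = "prob {\<omega> \<in> space M. 1 / 2 * expectation R < R \<omega>}"
    and ?P' = "prob {\<omega> \<in> space M. K / 2 < R \<omega>}"
  have pos: "0 < (expectation R)\<^sup>2"
    using large K by simp
  have "0 \<le> expectation (\<lambda>\<omega>. (R \<omega>)\<^sup>2)"
    by simp
  then have \<kappa>: "0 \<le> \<kappa>"
    using second_moment pos by (smt (verit) mult_neg_pos)
  have "(1 - 1 / 2)\<^sup>2 * (expectation R)\<^sup>2 \<le> expectation (\<lambda>\<omega>. (R \<omega>)\<^sup>2) * ?P"
    by (rule paley_zygmund[OF R]) simp_all
  also have "\<dots> \<le> \<kappa> * (expectation R)\<^sup>2 * ?P"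
    using second_moment by (rule mult_right_mono) simp
  also have "\<dots> \<le> \<kappa> * (expectation R)\<^sup>2 * ?P'"
    using large \<kappa> by (intro mult_left_mono finite_measure_mono) auto
  finally have "(1 / 4) * (expectation R)\<^sup>2 \<le> (\<kappa> * ?P') * (expectation R)\<^sup>2"
    by (simp add: power2_eq_square mult_ac)
  then show False
    using tail pos by simp
qed

lemma expectation_tendsto_zero_of_in_prob:
  assumes f: "tendsto_zero_in_prob f" "\<And>n. square_integrable M (f n)"
    and bound: "\<forall>\<^sub>F n in sequentially. expectation (\<lambda>\<omega>. (f n \<omega>)\<^sup>2) \<le> K"
  shows "(\<lambda>n. expectation (\<lambda>\<omega>. \<bar>f n \<omega>\<bar>)) \<longlonglongrightarrow> 0"
proof (rule order_tendstoI)
  fix e :: real assume e: "0 < e"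
  let ?P = "\<lambda>n. prob {\<omega> \<in> space M. e / 2 < \<bar>f n \<omega>\<bar>}"
  have "(\<lambda>n. sqrt K * sqrt (?P n)) \<longlonglongrightarrow> sqrt K * sqrt 0"
    using f(1)[unfolded tendsto_zero_in_prob_def, rule_format, of "e / 2"] e
    by (intro tendsto_intros) auto
  then have "\<forall>\<^sub>F n in sequentially. sqrt K * sqrt (?P n) < e / 2"
    using e by (intro order_tendstoD) auto
  with bound show "\<forall>\<^sub>F n in sequentially. expectation (\<lambda>\<omega>. \<bar>f n \<omega>\<bar>) < e"
  proof eventually_elim
    case (elim n)
    have "L2_norm M (f n) * sqrt (?P n) \<le> sqrt K * sqrt (?P n)"
      using elim(1) by (intro mult_right_mono) (auto simp: L2_norm_def)
    then show ?case
      using expectation_abs_le_truncation[OF f(2), of "e / 2" n] elim(2) e by simp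
  qed
next
  fix e :: real assume "e < 0"
  then show "\<forall>\<^sub>F n in sequentially. e < expectation (\<lambda>\<omega>. \<bar>f n \<omega>\<bar>)"
    by (intro always_eventually allI) (rule less_le_trans, auto)
qed

lemma tendsto_zero_in_prob_power:
  assumes f: "tendsto_zero_in_prob f" and k: "0 < k"
  shows "tendsto_zero_in_prob (\<lambda>n \<omega>. f n \<omega> ^ k)"
  unfolding tendsto_zero_in_prob_def
proof (intro allI impI)
  fix \<epsilon> :: real assume \<epsilon>: "0 < \<epsilon>"
  have "\<epsilon> < \<bar>f n \<omega> ^ k\<bar> \<longleftrightarrow> root k \<epsilon> < \<bar>f n \<omega>\<bar>" for n \<omega>
    using k \<epsilon> real_root_less_iff[OF k, of \<epsilon> "\<bar>f n \<omega>\<bar> ^ k"]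
    by (simp add: power_abs real_root_power_cancel)
  then show "(\<lambda>n. prob {\<omega> \<in> space M. \<epsilon> < \<bar>f n \<omega> ^ k\<bar>}) \<longlonglongrightarrow> 0"
    using f k \<epsilon> by (simp add: tendsto_zero_in_prob_def)
qed

end

section \<open>Gaussian integration by parts\<close>

definition poly_growth :: "(real \<Rightarrow> real) \<Rightarrow> bool" where
  "poly_growth f \<longleftrightarrow> (\<exists>C k. \<forall>y. \<bar>f y\<bar> \<le> C * (1 + \<bar>y\<bar>) ^ k)"

lemma poly_growthE:
  assumes "poly_growth f"
  obtains C k where "0 \<le> C" "\<And>y. \<bar>f y\<bar> \<le> C * (1 + \<bar>y\<bar>) ^ k"
proof -
  obtain C k where C: "\<bar>f y\<bar> \<le> C * (1 + \<bar>y\<bar>) ^ k" for y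
    using assms unfolding poly_growth_def by blast
  have "0 \<le> C"
    using C[of 0] abs_ge_zero[of "f 0"] by simp
  then show thesis
    using C by (rule that)
qed

lemma poly_growth_bounded: "(\<And>y. \<bar>f y\<bar> \<le> C) \<Longrightarrow> poly_growth f"
  unfolding poly_growth_def by (intro exI[of _ C] exI[of _ 0]) simp

lemma poly_growth_const: "poly_growth (\<lambda>_. a)"
  by (rule poly_growth_bounded[of _ "\<bar>a\<bar>"]) simp

lemma poly_growth_ident: "poly_growth (\<lambda>y. y)"
  unfolding poly_growth_def by (intro exI[of _ 1]) simp

lemma poly_growth_mult:
  assumes "poly_growth f" "poly_growth g"
  shows "poly_growth (\<lambda>y. f y * g y)"
proof -
  obtain C k where f: "0 \<le> C" "\<bar>f y\<bar> \<le> C * (1 + \<bar>y\<bar>) ^ k" for y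
    using assms(1) by (elim poly_growthE) blast
  obtain D l where g: "0 \<le> D" "\<bar>g y\<bar> \<le> D * (1 + \<bar>y\<bar>) ^ l" for y
    using assms(2) by (elim poly_growthE) blast
  have "\<bar>f y * g y\<bar> \<le> (C * D) * (1 + \<bar>y\<bar>) ^ (k + l)" for y
    using mult_mono[OF f(2)[of y] g(2)[of y]] f(1) by (simp add: abs_mult power_add mult_ac)
  then show ?thesis
    unfolding poly_growth_def by blast
qed

lemma poly_growth_add:
  assumes "poly_growth f" "poly_growth g"
  shows "poly_growth (\<lambda>y. f y + g y)"
proof -
  obtain C k where f: "0 \<le> C" "\<bar>f y\<bar> \<le> C * (1 + \<bar>y\<bar>) ^ k" for y
    using assms(1) by (elim poly_growthE) blast
  obtain D l where g: "0 \<le> D" "\<bar>g y\<bar> \<le> D * (1 + \<bar>y\<bar>) ^ l" for y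
    using assms(2) by (elim poly_growthE) blast
  have "\<bar>f y + g y\<bar> \<le> (C + D) * (1 + \<bar>y\<bar>) ^ (k + l)" for y
  proof -
    have "(1 + \<bar>y\<bar>) ^ k \<le> (1 + \<bar>y\<bar>) ^ (k + l)" "(1 + \<bar>y\<bar>) ^ l \<le> (1 + \<bar>y\<bar>) ^ (k + l)"
      by (intro power_increasing; simp)+
    then have "\<bar>f y\<bar> \<le> C * (1 + \<bar>y\<bar>) ^ (k + l)" "\<bar>g y\<bar> \<le> D * (1 + \<bar>y\<bar>) ^ (k + l)"
      using f g by (meson mult_left_mono order_trans)+
    then show ?thesis
      by (simp add: distrib_right)
  qed
  then show ?thesis
    unfolding poly_growth_def by blast
qed

lemma poly_growth_sum:
  assumes "\<And>i. i \<in> I \<Longrightarrow> poly_growth (f i)"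
  shows "poly_growth (\<lambda>y. \<Sum>i\<in>I. f i y)"
  using assms
  by (induction I rule: infinite_finite_induct) (auto intro: poly_growth_const poly_growth_add)

lemmas poly_growth_intros =
  poly_growth_const poly_growth_ident poly_growth_mult poly_growth_add poly_growth_sum

lemma integrable_std_normal_poly_growth:
  assumes f: "poly_growth f" and [measurable]: "f \<in> borel_measurable borel"
  shows "integrable lborel (\<lambda>y. std_normal_density y * f y)"
proof -
  obtain C k where C: "0 \<le> C" "\<bar>f y\<bar> \<le> C * (1 + \<bar>y\<bar>) ^ k" for y
    using f by (elim poly_growthE) blast
  have "integrable lborel
      (\<lambda>y. C * (\<Sum>i\<le>k. of_nat (k choose i) * (std_normal_density y * \<bar>y\<bar> ^ i)))"
    by (intro integrable_mult_right Bochner_Integration.integrable_sum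
        integrable_std_normal_moment_abs)
  moreover have "C * (\<Sum>i\<le>k. of_nat (k choose i) * (std_normal_density y * \<bar>y\<bar> ^ i))
      = std_normal_density y * (C * (1 + \<bar>y\<bar>) ^ k)" for y
    using binomial_ring[of "\<bar>y\<bar>" 1 k] by (simp add: sum_distrib_left add.commute mult_ac)
  ultimately have "integrable lborel (\<lambda>y. std_normal_density y * (C * (1 + \<bar>y\<bar>) ^ k))"
    by simp
  then show ?thesis
  proof (rule Bochner_Integration.integrable_bound)
    show "AE y in lborel. norm (std_normal_density y * f y)
        \<le> norm (std_normal_density y * (C * (1 + \<bar>y\<bar>) ^ k))"
      using C by (intro AE_I2) (simp add: abs_mult mult_left_mono)
  qed measurable
qed

lemma std_normal_poly_growth_tendsto_zero:
  assumes f: "poly_growth f"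
  shows "((\<lambda>y. std_normal_density y * f y) \<longlongrightarrow> 0) at_top"
    and "((\<lambda>y. std_normal_density y * f y) \<longlongrightarrow> 0) at_bot"
proof -
  obtain C k where C: "0 \<le> C" "\<bar>f y\<bar> \<le> C * (1 + \<bar>y\<bar>) ^ k" for y
    using f by (elim poly_growthE) blast
  have bound: "\<forall>\<^sub>F y in F. norm (std_normal_density y * f y)
      \<le> C / sqrt (2 * pi) * (exp (- y\<^sup>2 / 2) * (1 + \<bar>y\<bar>) ^ k)" for F
  proof (intro always_eventually allI)
    fix y
    have "norm (std_normal_density y * f y) \<le> std_normal_density y * (C * (1 + \<bar>y\<bar>) ^ k)"
      using C by (simp add: abs_mult mult_left_mono)
    then show "norm (std_normal_density y * f y)
        \<le> C / sqrt (2 * pi) * (exp (- y\<^sup>2 / 2) * (1 + \<bar>y\<bar>) ^ k)"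
      by (simp add: std_normal_density_def field_simps)
  qed
  have limits: "((\<lambda>y::real. exp (- y\<^sup>2 / 2) * (1 + \<bar>y\<bar>) ^ k) \<longlongrightarrow> 0) at_top"
    "((\<lambda>y::real. exp (- y\<^sup>2 / 2) * (1 + \<bar>y\<bar>) ^ k) \<longlongrightarrow> 0) at_bot"
    by real_asymp+
  show "((\<lambda>y. std_normal_density y * f y) \<longlongrightarrow> 0) at_top"
    by (rule Lim_null_comparison[OF bound tendsto_mult_right_zero[OF limits(1)]])
  show "((\<lambda>y. std_normal_density y * f y) \<longlongrightarrow> 0) at_bot"
    by (rule Lim_null_comparison[OF bound tendsto_mult_right_zero[OF limits(2)]])
qed

lemma std_normal_stein_identity:
  assumes f: "poly_growth f" "\<And>y. (f has_real_derivative f' y) (at y)"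
    and f': "poly_growth f'" "\<And>y. isCont f' y"
  shows "(\<integral>y. y * f y - f' y \<partial>std_normal_distribution) = 0"
proof -
  have f_cont: "isCont f y" for y
    using f(2) by (rule DERIV_isCont)
  then have [measurable]: "f \<in> borel_measurable borel" "f' \<in> borel_measurable borel"
    using f'(2)
    by (auto intro!: borel_measurable_continuous_onI continuous_at_imp_continuous_on)
  let ?F = "\<lambda>y. std_normal_density y * f y"
  let ?F' = "\<lambda>y. std_normal_density y * (f' y - y * f y)"
  have density: "(std_normal_density has_real_derivative - y * std_normal_density y) (at y)" for y
    unfolding std_normal_density_def by (auto intro!: derivative_eq_intros simp: field_simps)
  have derivative: "(?F has_vector_derivative ?F' y) (at y)" for y
    unfolding has_real_derivative_iff_has_vector_derivative[symmetric]
    by (auto intro!: derivative_eq_intros f(2) density simp: algebra_simps)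
  have "poly_growth (\<lambda>y. f' y + (- 1) * (y * f y))"
    by (intro poly_growth_intros f f')
  then have "integrable lborel ?F'"
    by (intro integrable_std_normal_poly_growth) simp_all
  moreover have "(LBINT y=-\<infinity>..\<infinity>. ?F' y) = 0 - 0"
  proof (rule interval_integral_FTC_integrable)
    show "set_integrable lborel (einterval (- \<infinity>) \<infinity>) ?F'"
      using \<open>integrable lborel ?F'\<close> by (simp add: set_integrable_def)
    show "isCont ?F' y" for y
      using density[THEN DERIV_isCont] by (intro continuous_intros f_cont f'(2))
    show "((?F \<circ> real_of_ereal) \<longlongrightarrow> 0) (at_right (- \<infinity>))" "((?F \<circ> real_of_ereal) \<longlongrightarrow> 0) (at_left \<infinity>)"
      using std_normal_poly_growth_tendsto_zero[OF f(1)] by (simp_all add: ereal_tendsto_simps)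
  qed (use derivative in auto)
  ultimately have "(\<integral>y. - ?F' y \<partial>lborel) = 0"
    by (simp add: interval_lebesgue_integral_def set_lebesgue_integral_def)
  also have "(\<lambda>y. - ?F' y) = (\<lambda>y. std_normal_density y * (y * f y - f' y))"
    by (simp add: algebra_simps)
  finally show ?thesis
    by (subst integral_density) auto
qed

lemma integrable_mult_bounded:
  fixes f g :: "'a \<Rightarrow> real"
  assumes f: "integrable M f" and g: "g \<in> borel_measurable M" "\<And>x. \<bar>g x\<bar> \<le> C"
  shows "integrable M (\<lambda>x. f x * g x)"
proof (rule Bochner_Integration.integrable_bound)
  show "integrable M (\<lambda>x. C * f x)"
    using f by simp
  show "(\<lambda>x. f x * g x) \<in> borel_measurable M"
    using f g by measurable
  have "\<bar>f x\<bar> * \<bar>g x\<bar> \<le> \<bar>f x\<bar> * \<bar>C\<bar>" for x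
    using g(2)[of x] by (intro mult_left_mono) auto
  then show "AE x in M. norm (f x * g x) \<le> norm (C * f x)"
    by (simp add: abs_mult mult.commute)
qed

definition sum_squares :: "'i set \<Rightarrow> ('i \<Rightarrow> 'a \<Rightarrow> real) \<Rightarrow> 'a \<Rightarrow> real" where
  "sum_squares I Y \<omega> = (\<Sum>i\<in>I. (Y i \<omega>)\<^sup>2)"

lemma sum_squares_nonneg: "0 \<le> sum_squares I Y \<omega>"
  by (simp add: sum_squares_def sum_nonneg)

lemma borel_measurable_sum_squares:
  "(\<And>i. i \<in> I \<Longrightarrow> Y i \<in> borel_measurable M) \<Longrightarrow> sum_squares I Y \<in> borel_measurable M"
  unfolding sum_squares_def[abs_def] by simp

definition linear_form :: "nat \<Rightarrow> (nat \<Rightarrow> real) \<Rightarrow> (nat \<Rightarrow> real) \<Rightarrow> real" where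
  "linear_form m b x = (\<Sum>k<m. b k * x k)"

lemma linear_form_scale: "linear_form m (\<lambda>k. t * b k) x = t * linear_form m b x"
  by (simp add: linear_form_def sum_distrib_left mult.assoc)

lemma linear_form_add: "linear_form m (\<lambda>k. b k + c k) x = linear_form m b x + linear_form m c x"
  by (simp add: linear_form_def sum.distrib distrib_right)

lemma linear_form_restrict: "linear_form m b (restrict x {..<m}) = linear_form m b x"
  by (simp add: linear_form_def)

lemma linear_form_upd:
  assumes "l < m"
  shows "linear_form m b (x(l := y)) = b l * y + (linear_form m b x - b l * x l)"
proof -
  have "linear_form m b (x(l := y)) = (\<Sum>k<m. b k * x k + (if k = l then b l * (y - x l) else 0))"
    unfolding linear_form_def by (intro sum.cong) (auto simp: algebra_simps)
  then show ?thesis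
    using assms by (simp add: sum.distrib linear_form_def algebra_simps)
qed

lemma has_real_derivative_linear_form_upd:
  "l < m \<Longrightarrow> ((\<lambda>y. linear_form m b (x(l := y))) has_real_derivative b l) (at y)"
  by (simp add: linear_form_upd) (auto intro!: derivative_eq_intros)

lemma poly_growth_linear_form_upd:
  "l < m \<Longrightarrow> poly_growth (\<lambda>y. linear_form m b (x(l := y)))"
  by (simp add: linear_form_upd) (intro poly_growth_intros)

locale gaussian_sequence = prob_space M for M :: "'a measure" +
  fixes N :: "nat \<Rightarrow> 'a \<Rightarrow> real"
  assumes indep: "indep_vars (\<lambda>_. borel) N UNIV"
    and std: "\<And>i. distributed M lborel (N i) std_normal_density"
begin

lemma N_measurable [measurable]: "N i \<in> borel_measurable M"
  using distributed_measurable[OF std[of i]] by simp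

lemma distr_N: "distr M borel (N i) = std_normal_distribution"
  using distributed_distr_eq_density[OF std[of i]] by (metis distr_cong sets_lborel)

lemma square_integrable_N: "square_integrable M (N i)"
proof -
  have "integrable (distr M borel (N i)) (\<lambda>x. x\<^sup>2)"
    unfolding distr_N by (subst integrable_density) (auto simp: integrable_std_normal_moment)
  then show ?thesis
    by (subst (asm) integrable_distr_eq) (auto simp: square_integrable_def)
qed

lemma stein_identity_coordinate:
  fixes f f' :: "(nat \<Rightarrow> real) \<Rightarrow> real"
  assumes l: "l < m"
    and f: "f \<in> borel_measurable (Pi\<^sub>M {..<m} (\<lambda>_. borel))"
      "\<And>x. poly_growth (\<lambda>y. f (x(l := y)))"
      "\<And>x y. ((\<lambda>y. f (x(l := y))) has_real_derivative f' (x(l := y))) (at y)"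
      "integrable M (\<lambda>\<omega>. N l \<omega> * f (\<lambda>i\<in>{..<m}. N i \<omega>))"
    and f': "f' \<in> borel_measurable (Pi\<^sub>M {..<m} (\<lambda>_. borel))"
      "\<And>x. poly_growth (\<lambda>y. f' (x(l := y)))" "\<And>x y. isCont (\<lambda>y. f' (x(l := y))) y"
      "integrable M (\<lambda>\<omega>. f' (\<lambda>i\<in>{..<m}. N i \<omega>))"
  shows "expectation (\<lambda>\<omega>. N l \<omega> * f (\<lambda>i\<in>{..<m}. N i \<omega>)) = expectation (\<lambda>\<omega>. f' (\<lambda>i\<in>{..<m}. N i \<omega>))"
proof -
  define P where "P = (\<lambda>_::nat. std_normal_distribution)"
  interpret P: product_prob_space P
    unfolding P_def product_prob_space_def product_prob_space_axioms_def product_sigma_finite_def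
    using prob_space_normal_density[of 1 0] by (auto intro!: prob_space_imp_sigma_finite)
  define g where "g x = x l * f x - f' x" for x
  let ?X = "\<lambda>\<omega>. \<lambda>i\<in>{..<m}. N i \<omega>"
  have law: "distr M (Pi\<^sub>M {..<m} (\<lambda>_. borel)) ?X = Pi\<^sub>M {..<m} P"
    using indep_vars_iff_distr_eq_PiM[where I = "{..<m}" and M' = "\<lambda>_. borel" and X = N] l
      indep_vars_subset[OF indep, of "{..<m}"]
    by (auto simp: P_def distr_N)
  have [measurable]: "(\<lambda>x. x l) \<in> borel_measurable (Pi\<^sub>M {..<m} (\<lambda>_. borel))"
    using l by simp
  note f(1)[measurable] f'(1)[measurable]
  have g [measurable]: "g \<in> borel_measurable (Pi\<^sub>M {..<m} (\<lambda>_. borel))"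
    unfolding g_def by measurable
  have g_X: "(\<lambda>\<omega>. g (?X \<omega>)) = (\<lambda>\<omega>. N l \<omega> * f (?X \<omega>) - f' (?X \<omega>))"
    using l by (simp add: g_def)
  have "integrable (Pi\<^sub>M {..<m} P) g"
    unfolding law[symmetric] using f(4) f'(4) by (subst integrable_distr_eq) (auto simp: g_X)
  moreover have "(\<integral>y. g (x(l := y)) \<partial>P l) = 0" for x
    using std_normal_stein_identity[OF f(2,3) f'(2,3)] by (simp add: P_def g_def)
  moreover have "{..<m} = insert l ({..<m} - {l})"
    using l by auto
  ultimately have "integral\<^sup>L (Pi\<^sub>M {..<m} P) g = 0"
    using P.product_integral_insert[of "{..<m} - {l}" l g] by simp
  then have "expectation (\<lambda>\<omega>. g (?X \<omega>)) = 0"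
    unfolding law[symmetric] by (subst (asm) integral_distr) auto
  then show ?thesis
    unfolding g_X using f(4) f'(4) by simp
qed

definition gauss_span :: "('a \<Rightarrow> real) set" where
  "gauss_span = {Z. \<exists>m c. Z = (\<lambda>\<omega>. linear_form m c (\<lambda>l. N l \<omega>))}"

lemma gauss_spanI: "(\<lambda>\<omega>. linear_form m c (\<lambda>l. N l \<omega>)) \<in> gauss_span"
  by (auto simp: gauss_span_def)

lemma gauss_span_common_coefficients:
  assumes S: "finite S" "S \<subseteq> gauss_span"
  obtains m c where "\<And>Z \<omega>. Z \<in> S \<Longrightarrow> Z \<omega> = linear_form m (c Z) (\<lambda>l. N l \<omega>)"
proof -
  have "\<forall>Z\<in>S. \<exists>m c. Z = (\<lambda>\<omega>. linear_form m c (\<lambda>l. N l \<omega>))"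
    using S(2) by (auto simp: gauss_span_def)
  then obtain m c where mc: "\<And>Z. Z \<in> S \<Longrightarrow> Z = (\<lambda>\<omega>. linear_form (m Z) (c Z) (\<lambda>l. N l \<omega>))"
    by metis
  define c' where "c' Z l = (if l < m Z then c Z l else 0)" for Z l
  show thesis
  proof (rule that)
    fix Z \<omega> assume Z: "Z \<in> S"
    then have "m Z \<le> Max (m ` S)"
      using S(1) by simp
    then have "linear_form (m Z) (c Z) (\<lambda>l. N l \<omega>) = linear_form (Max (m ` S)) (c' Z) (\<lambda>l. N l \<omega>)"
      unfolding linear_form_def by (intro sum.mono_neutral_cong_left) (auto simp: c'_def)
    then show "Z \<omega> = linear_form (Max (m ` S)) (c' Z) (\<lambda>l. N l \<omega>)"
      using mc[OF Z] by metis
  qed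
qed

lemma gauss_span_square_integrable: "Z \<in> gauss_span \<Longrightarrow> square_integrable M Z"
  unfolding gauss_span_def linear_form_def
  by (auto intro!: square_integrable_sum square_integrable_scale square_integrable_N)

lemma gauss_span_zero: "(\<lambda>_. 0) \<in> gauss_span"
  using gauss_spanI[of 0] by (simp add: linear_form_def)

lemma gauss_span_scale: "Z \<in> gauss_span \<Longrightarrow> (\<lambda>\<omega>. t * Z \<omega>) \<in> gauss_span"
  unfolding gauss_span_def by (auto; metis linear_form_scale)

lemma gauss_span_add:
  assumes "Y \<in> gauss_span" "Z \<in> gauss_span"
  shows "(\<lambda>\<omega>. Y \<omega> + Z \<omega>) \<in> gauss_span"
proof -
  obtain m c where "\<And>V \<omega>. V \<in> {Y, Z} \<Longrightarrow> V \<omega> = linear_form m (c V) (\<lambda>l. N l \<omega>)"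
    using gauss_span_common_coefficients[of "{Y, Z}"] assms by blast
  then have "(\<lambda>\<omega>. Y \<omega> + Z \<omega>) = (\<lambda>\<omega>. linear_form m (\<lambda>l. c Y l + c Z l) (\<lambda>l. N l \<omega>))"
    by (simp add: linear_form_add)
  then show ?thesis
    by (simp add: gauss_spanI)
qed

end

definition bounded_C1_nonneg :: "(real \<Rightarrow> real) \<Rightarrow> (real \<Rightarrow> real) \<Rightarrow> bool" where
  "bounded_C1_nonneg \<psi> \<psi>' \<longleftrightarrow>
     \<psi> \<in> borel_measurable borel \<and> \<psi>' \<in> borel_measurable borel \<and>
     (\<forall>q\<ge>0. (\<psi> has_real_derivative \<psi>' q) (at q) \<and> isCont \<psi>' q) \<and>
     (\<exists>C. \<forall>q\<ge>0. \<bar>\<psi> q\<bar> \<le> C \<and> \<bar>\<psi>' q\<bar> \<le> C)"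

lemma bounded_C1_nonneg_const: "bounded_C1_nonneg (\<lambda>_. a) (\<lambda>_. 0)"
  by (auto simp: bounded_C1_nonneg_def intro!: exI[of _ "\<bar>a\<bar>"])

lemma bounded_C1_nonneg_inverse_power:
  assumes \<delta>: "0 < \<delta>"
  shows "bounded_C1_nonneg (\<lambda>q. 1 / (\<delta> + q) ^ n) (\<lambda>q. - real n / (\<delta> + q) ^ Suc n)"
  unfolding bounded_C1_nonneg_def
proof (intro conjI allI impI)
  fix q :: real assume q: "0 \<le> q"
  show "((\<lambda>q. 1 / (\<delta> + q) ^ n) has_real_derivative - real n / (\<delta> + q) ^ Suc n) (at q)"
  proof -
    have "((\<lambda>x. 1 / x ^ n) has_real_derivative - real n / x ^ Suc n) (at x)" if "x \<noteq> 0" for x :: real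
      using that by (auto intro!: derivative_eq_intros) (cases n; simp add: field_simps)
    from this[of "q + \<delta>"] show ?thesis
      using q \<delta> unfolding DERIV_shift by (simp add: add.commute)
  qed
  show "isCont (\<lambda>q. - real n / (\<delta> + q) ^ Suc n) q"
    using q \<delta> by (intro continuous_intros) auto
next
  have "1 / (\<delta> + q) ^ k \<le> 1 / \<delta> ^ k" if "0 \<le> q" for q k
    using that \<delta> by (intro divide_left_mono power_mono) auto
  then have "\<bar>1 / (\<delta> + q) ^ n\<bar> \<le> max (1 / \<delta> ^ n) (real n * (1 / \<delta> ^ Suc n))"
    "\<bar>- real n / (\<delta> + q) ^ Suc n\<bar> \<le> max (1 / \<delta> ^ n) (real n * (1 / \<delta> ^ Suc n))" if "0 \<le> q" for q
    using that \<delta> mult_left_mono[of "1 / (\<delta> + q) ^ Suc n" "1 / \<delta> ^ Suc n" "real n"]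
    by (auto simp: le_max_iff_disj simp del: power_Suc)
  then show "\<exists>C. \<forall>q\<ge>0. \<bar>1 / (\<delta> + q) ^ n\<bar> \<le> C \<and> \<bar>- real n / (\<delta> + q) ^ Suc n\<bar> \<le> C"
    by blast
qed measurable

context prob_space
begin

lemma integrable_mult_bounded_C1:
  assumes \<psi>: "bounded_C1_nonneg \<psi> \<psi>'" and Q: "Q \<in> borel_measurable M" "\<And>\<omega>. 0 \<le> Q \<omega>"
    and X: "integrable M X"
  shows "integrable M (\<lambda>\<omega>. X \<omega> * \<psi> (Q \<omega>))" "integrable M (\<lambda>\<omega>. X \<omega> * \<psi>' (Q \<omega>))"
proof -
  obtain C where "\<And>q. 0 \<le> q \<Longrightarrow> \<bar>\<psi> q\<bar> \<le> C" "\<And>q. 0 \<le> q \<Longrightarrow> \<bar>\<psi>' q\<bar> \<le> C"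
    using \<psi> unfolding bounded_C1_nonneg_def by blast
  moreover have [measurable]: "\<psi> \<in> borel_measurable borel" "\<psi>' \<in> borel_measurable borel"
    using \<psi> by (simp_all add: bounded_C1_nonneg_def)
  note Q(1)[measurable]
  ultimately show "integrable M (\<lambda>\<omega>. X \<omega> * \<psi> (Q \<omega>))" "integrable M (\<lambda>\<omega>. X \<omega> * \<psi>' (Q \<omega>))"
    using Q(2) by (auto intro!: integrable_mult_bounded[OF X, where C = C])
qed

end

lemma stein_integrand_sum_squares:
  fixes a :: "nat \<Rightarrow> real" and c :: "'i \<Rightarrow> nat \<Rightarrow> real" and l m :: nat and I :: "'i set"
    and \<psi> \<psi>' :: "real \<Rightarrow> real"
  defines "S \<equiv> sum_squares I (\<lambda>j. linear_form m (c j))"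
  defines "f \<equiv> \<lambda>x. linear_form m a x * \<psi> (S x)"
  defines "f' \<equiv> \<lambda>x. a l * \<psi> (S x)
      + linear_form m a x * (2 * (\<Sum>j\<in>I. c j l * linear_form m (c j) x) * \<psi>' (S x))"
  assumes \<psi>: "bounded_C1_nonneg \<psi> \<psi>'" and l: "l < m"
  shows "((\<lambda>y. f (x(l := y))) has_real_derivative f' (x(l := y))) (at y)"
    and "isCont (\<lambda>y. f' (x(l := y))) y"
    and "poly_growth (\<lambda>y. f (x(l := y)))" "poly_growth (\<lambda>y. f' (x(l := y)))"
proof -
  obtain C where C: "\<And>q. 0 \<le> q \<Longrightarrow> \<bar>\<psi> q\<bar> \<le> C" "\<And>q. 0 \<le> q \<Longrightarrow> \<bar>\<psi>' q\<bar> \<le> C"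
    using \<psi> unfolding bounded_C1_nonneg_def by blast
  have \<psi>_deriv: "0 \<le> q \<Longrightarrow> (\<psi> has_real_derivative \<psi>' q) (at q)"
    and \<psi>'_cont: "0 \<le> q \<Longrightarrow> isCont \<psi>' q" for q
    using \<psi> by (simp_all add: bounded_C1_nonneg_def)
  have S_nonneg: "0 \<le> S x" for x
    by (simp add: S_def sum_squares_nonneg)
  note L_deriv = has_real_derivative_linear_form_upd[OF l]
  have S_deriv: "((\<lambda>y. S (x(l := y))) has_real_derivative
      2 * (\<Sum>j\<in>I. c j l * linear_form m (c j) (x(l := y)))) (at y)" for x y
    unfolding S_def sum_squares_def
    by (auto intro!: derivative_eq_intros L_deriv simp: sum_distrib_left mult_ac)
  show "((\<lambda>y. f (x(l := y))) has_real_derivative f' (x(l := y))) (at y)" for x y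
    unfolding f_def f'_def
    by (rule derivative_eq_intros L_deriv DERIV_chain2[OF \<psi>_deriv S_deriv] S_nonneg refl)+ simp
  show "isCont (\<lambda>y. f' (x(l := y))) y" for x y
    unfolding f'_def
    using L_deriv[THEN DERIV_isCont] S_deriv[THEN DERIV_isCont]
    by (intro continuous_intros isCont_o2[OF _ \<psi>'_cont]
        isCont_o2[OF _ DERIV_isCont[OF \<psi>_deriv]] S_nonneg)
  have \<psi>_growth: "poly_growth (\<lambda>y. \<psi> (S (x(l := y))))" "poly_growth (\<lambda>y. \<psi>' (S (x(l := y))))" for x
    by (intro poly_growth_bounded[where C = C] C S_nonneg)+
  show "poly_growth (\<lambda>y. f (x(l := y)))" "poly_growth (\<lambda>y. f' (x(l := y)))"
    unfolding f_def f'_def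
    by (intro poly_growth_intros \<psi>_growth poly_growth_linear_form_upd[OF l])+
qed

context gaussian_sequence
begin

lemma stein_identity_sum_squares_coordinate:
  fixes a :: "nat \<Rightarrow> real" and c :: "'i \<Rightarrow> nat \<Rightarrow> real" and m :: nat and I :: "'i set"
  defines "U \<equiv> \<lambda>\<omega>. linear_form m a (\<lambda>l. N l \<omega>)" and "Y \<equiv> \<lambda>j \<omega>. linear_form m (c j) (\<lambda>l. N l \<omega>)"
  defines "Q \<equiv> sum_squares I Y"
  assumes \<psi>: "bounded_C1_nonneg \<psi> \<psi>'" and l: "l < m"
  shows "expectation (\<lambda>\<omega>. N l \<omega> * U \<omega> * \<psi> (Q \<omega>))
    = a l * expectation (\<lambda>\<omega>. \<psi> (Q \<omega>))
      + 2 * (\<Sum>j\<in>I. c j l * expectation (\<lambda>\<omega>. U \<omega> * Y j \<omega> * \<psi>' (Q \<omega>)))"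
proof -
  define S where "S = sum_squares I (\<lambda>j. linear_form m (c j))"
  define f where "f x = linear_form m a x * \<psi> (S x)" for x
  define f' where "f' x = a l * \<psi> (S x)
      + linear_form m a x * (2 * (\<Sum>j\<in>I. c j l * linear_form m (c j) x) * \<psi>' (S x))" for x
  let ?X = "\<lambda>\<omega>. \<lambda>i\<in>{..<m}. N i \<omega>"
  have [measurable]: "\<psi> \<in> borel_measurable borel" "\<psi>' \<in> borel_measurable borel"
    using \<psi> by (simp_all add: bounded_C1_nonneg_def)
  have [measurable]: "linear_form m b \<in> borel_measurable (Pi\<^sub>M {..<m} (\<lambda>_. borel))" for b
    unfolding linear_form_def[abs_def] by measurable
  have [measurable]: "S \<in> borel_measurable (Pi\<^sub>M {..<m} (\<lambda>_. borel))"
    unfolding S_def by (rule borel_measurable_sum_squares) measurable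
  have U: "square_integrable M U" and Y: "square_integrable M (Y j)" for j
    unfolding U_def Y_def by (intro gauss_span_square_integrable gauss_spanI)+
  have Q: "Q \<in> borel_measurable M" "\<And>\<omega>. 0 \<le> Q \<omega>"
    unfolding Q_def using Y
    by (auto intro: borel_measurable_sum_squares square_integrable_measurable simp: sum_squares_nonneg)
  have S_X: "S (?X \<omega>) = Q \<omega>" for \<omega>
    by (simp add: S_def Q_def sum_squares_def linear_form_restrict Y_def)
  have f_X: "f (?X \<omega>) = U \<omega> * \<psi> (Q \<omega>)" for \<omega>
    by (simp only: f_def linear_form_restrict S_X U_def)
  have f'_X: "f' (?X \<omega>) = a l * (1 * \<psi> (Q \<omega>)) + 2 * (\<Sum>j\<in>I. c j l * (U \<omega> * Y j \<omega> * \<psi>' (Q \<omega>)))" for \<omega>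
    unfolding f'_def linear_form_restrict S_X
    by (simp add: U_def Y_def sum_distrib_left sum_distrib_right mult_ac)
  note integrable_\<psi> = integrable_mult_bounded_C1[OF \<psi> Q]
  have integrable_1: "integrable M (\<lambda>\<omega>. 1 * \<psi> (Q \<omega>))"
    by (intro integrable_\<psi>) simp
  have integrable_UY: "integrable M (\<lambda>\<omega>. U \<omega> * Y j \<omega> * \<psi>' (Q \<omega>))" for j
    by (intro integrable_\<psi> square_integrable_imp_integrable_mult U Y)
  have "expectation (\<lambda>\<omega>. N l \<omega> * f (?X \<omega>)) = expectation (\<lambda>\<omega>. f' (?X \<omega>))"
  proof (rule stein_identity_coordinate[OF l])
    show "integrable M (\<lambda>\<omega>. N l \<omega> * f (?X \<omega>))"
      unfolding f_X mult.assoc[symmetric]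
      by (intro integrable_\<psi> square_integrable_imp_integrable_mult square_integrable_N U)
    show "integrable M (\<lambda>\<omega>. f' (?X \<omega>))"
      unfolding f'_X
      by (intro Bochner_Integration.integrable_add integrable_mult_right
          Bochner_Integration.integrable_sum integrable_1 integrable_UY)
    show "f \<in> borel_measurable (Pi\<^sub>M {..<m} (\<lambda>_. borel))"
      "f' \<in> borel_measurable (Pi\<^sub>M {..<m} (\<lambda>_. borel))"
      unfolding f_def[abs_def] f'_def[abs_def] by measurable
  qed (unfold f_def f'_def S_def, (rule stein_integrand_sum_squares[OF \<psi> l])+)
  then show ?thesis
    unfolding f_X f'_X using integrable_1 integrable_UY by (simp add: mult.assoc)
qed

lemma expectation_N_mult_linear_form:
  "l < m \<Longrightarrow> expectation (\<lambda>\<omega>. N l \<omega> * linear_form m a (\<lambda>l. N l \<omega>)) = a l"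
  using stein_identity_sum_squares_coordinate[OF bounded_C1_nonneg_const[of 1], where a = a and I = "{}"]
  by (simp add: prob_space)

lemma expectation_linear_form_mult:
  assumes "\<And>l. integrable M (\<lambda>\<omega>. N l \<omega> * W \<omega>)"
  shows "expectation (\<lambda>\<omega>. linear_form m b (\<lambda>l. N l \<omega>) * W \<omega>)
    = (\<Sum>l<m. b l * expectation (\<lambda>\<omega>. N l \<omega> * W \<omega>))"
  using assms by (simp add: linear_form_def sum_distrib_right mult.assoc)

lemma expectation_linear_form_mult_linear_form:
  "expectation (\<lambda>\<omega>. linear_form m a (\<lambda>l. N l \<omega>) * linear_form m b (\<lambda>l. N l \<omega>)) = (\<Sum>l<m. a l * b l)"
  by (subst expectation_linear_form_mult)
    (auto intro!: square_integrable_imp_integrable_mult square_integrable_N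
      gauss_span_square_integrable gauss_spanI simp: expectation_N_mult_linear_form)

lemma stein_identity_gauss_span:
  fixes I :: "'i set"
  assumes \<psi>: "bounded_C1_nonneg \<psi> \<psi>'" and I: "finite I"
    and X: "X \<in> gauss_span" and U: "U \<in> gauss_span" and Y: "\<And>i. i \<in> I \<Longrightarrow> Y i \<in> gauss_span"
  defines "Q \<equiv> sum_squares I Y"
  shows "expectation (\<lambda>\<omega>. X \<omega> * U \<omega> * \<psi> (Q \<omega>)) = expectation (\<lambda>\<omega>. X \<omega> * U \<omega>) * expectation (\<lambda>\<omega>. \<psi> (Q \<omega>))
      + 2 * (\<Sum>j\<in>I. expectation (\<lambda>\<omega>. X \<omega> * Y j \<omega>) * expectation (\<lambda>\<omega>. U \<omega> * Y j \<omega> * \<psi>' (Q \<omega>)))"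
proof -
  obtain m b where b: "\<And>V \<omega>. V \<in> {X, U} \<union> Y ` I \<Longrightarrow> V \<omega> = linear_form m (b V) (\<lambda>l. N l \<omega>)"
    using gauss_span_common_coefficients[of "{X, U} \<union> Y ` I"] I X U Y by auto
  let ?E = "\<lambda>j. expectation (\<lambda>\<omega>. U \<omega> * Y j \<omega> * \<psi>' (Q \<omega>))"
  have Y_form: "Y j \<omega> = linear_form m (b (Y j)) (\<lambda>l. N l \<omega>)" if "j \<in> I" for j \<omega>
    using that by (intro b) simp
  have covariance: "expectation (\<lambda>\<omega>. X \<omega> * V \<omega>) = (\<Sum>l<m. b X l * b V l)"
    if "V \<in> {X, U} \<union> Y ` I" for V
    using expectation_linear_form_mult_linear_form[of m "b X" "b V"] b[of X] b[OF that] by simp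
  have Q: "Q \<in> borel_measurable M" "\<And>\<omega>. 0 \<le> Q \<omega>"
    unfolding Q_def using Y gauss_span_square_integrable
    by (auto intro: borel_measurable_sum_squares square_integrable_measurable simp: sum_squares_nonneg)
  have "Q = sum_squares I (\<lambda>j \<omega>. linear_form m (b (Y j)) (\<lambda>l. N l \<omega>))"
    unfolding Q_def sum_squares_def[abs_def] by (intro ext sum.cong refl) (simp only: Y_form)
  then have coordinate: "expectation (\<lambda>\<omega>. N l \<omega> * (U \<omega> * \<psi> (Q \<omega>)))
      = b U l * expectation (\<lambda>\<omega>. \<psi> (Q \<omega>)) + 2 * (\<Sum>j\<in>I. b (Y j) l * ?E j)" if "l < m" for l
    using stein_identity_sum_squares_coordinate[OF \<psi> that, of "b U" I "\<lambda>j. b (Y j)"] b[of U]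
    by (simp add: mult.assoc Y_form[symmetric])
  have "integrable M (\<lambda>\<omega>. N l \<omega> * (U \<omega> * \<psi> (Q \<omega>)))" for l
    unfolding mult.assoc[symmetric]
    by (intro integrable_mult_bounded_C1[OF \<psi> Q] square_integrable_imp_integrable_mult
        square_integrable_N gauss_span_square_integrable U)
  then have "expectation (\<lambda>\<omega>. X \<omega> * (U \<omega> * \<psi> (Q \<omega>)))
      = (\<Sum>l<m. b X l * (b U l * expectation (\<lambda>\<omega>. \<psi> (Q \<omega>)) + 2 * (\<Sum>j\<in>I. b (Y j) l * ?E j)))"
    using expectation_linear_form_mult[of "\<lambda>\<omega>. U \<omega> * \<psi> (Q \<omega>)" m "b X"] b[of X]
    by (simp add: coordinate)
  also have "\<dots> = (\<Sum>l<m. b X l * b U l) * expectation (\<lambda>\<omega>. \<psi> (Q \<omega>))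
      + 2 * (\<Sum>l<m. \<Sum>j\<in>I. (b X l * b (Y j) l) * ?E j)"
    by (simp add: distrib_left sum.distrib sum_distrib_left sum_distrib_right mult_ac)
  also have "(\<Sum>l<m. \<Sum>j\<in>I. (b X l * b (Y j) l) * ?E j) = (\<Sum>j\<in>I. (\<Sum>l<m. b X l * b (Y j) l) * ?E j)"
    by (subst sum.swap) (simp add: sum_distrib_right)
  finally show ?thesis
    by (simp add: covariance mult.assoc)
qed

end

section \<open>The first Wiener chaos\<close>

context gaussian_sequence
begin

lemma chaos_iff_tendsto_L2:
  "X \<in> first_wiener_chaos M N \<longleftrightarrow>
     square_integrable M X \<and> (\<exists>Z. (\<forall>k. Z k \<in> gauss_span) \<and> tendsto_L2 M Z X)"
proof -
  have L2: "(\<lambda>k. \<integral>\<^sup>+\<omega>. ennreal ((X \<omega> - Z k \<omega>)\<^sup>2) \<partial>M) \<longlonglongrightarrow> 0 \<longleftrightarrow> tendsto_L2 M Z X"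
    if X: "square_integrable M X" and Z: "\<And>k. Z k \<in> gauss_span" for Z
  proof -
    have "(\<integral>\<^sup>+\<omega>. ennreal ((X \<omega> - Z k \<omega>)\<^sup>2) \<partial>M) = ennreal ((L2_norm M (\<lambda>\<omega>. Z k \<omega> - X \<omega>))\<^sup>2)" for k
      unfolding L2_norm_power2 power2_commute[of "X _"]
      by (intro nn_integral_eq_integral square_integrable_imp_integrable_square
          square_integrable_diff X gauss_span_square_integrable Z) simp
    then show ?thesis
      by (simp add: tendsto_L2_def ennreal_tendsto_0_iff)
  qed
  have sums: "(\<forall>k. Z k \<in> gauss_span) \<longleftrightarrow> (\<exists>m c. Z = (\<lambda>k \<omega>. \<Sum>i<m k. c k i * N i \<omega>))"
    for Z :: "nat \<Rightarrow> 'a \<Rightarrow> real"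
    by (simp only: gauss_span_def linear_form_def mem_Collect_eq fun_eq_iff choice_iff)
  have "X \<in> first_wiener_chaos M N \<longleftrightarrow> square_integrable M X \<and>
      (\<exists>m c. (\<lambda>k. \<integral>\<^sup>+\<omega>. ennreal ((X \<omega> - (\<Sum>i<m k. c k i * N i \<omega>))\<^sup>2) \<partial>M) \<longlonglongrightarrow> 0)"
    by (simp add: first_wiener_chaos_def square_integrable_def)
  also have "\<dots> \<longleftrightarrow> square_integrable M X \<and>
      (\<exists>Z. (\<forall>k. Z k \<in> gauss_span) \<and> (\<lambda>k. \<integral>\<^sup>+\<omega>. ennreal ((X \<omega> - Z k \<omega>)\<^sup>2) \<partial>M) \<longlonglongrightarrow> 0)"
    unfolding sums by blast
  finally show ?thesis
    using L2 by blast
qed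

lemma chaos_square_integrable: "X \<in> first_wiener_chaos M N \<Longrightarrow> square_integrable M X"
  by (simp add: chaos_iff_tendsto_L2)

lemma chaos_measurable [measurable_dest]: "X \<in> first_wiener_chaos M N \<Longrightarrow> X \<in> borel_measurable M"
  by (intro square_integrable_measurable chaos_square_integrable)

lemma gauss_span_subset_chaos: "gauss_span \<subseteq> first_wiener_chaos M N"
proof
  fix Z assume "Z \<in> gauss_span"
  then show "Z \<in> first_wiener_chaos M N"
    unfolding chaos_iff_tendsto_L2
    by (intro conjI exI[of _ "\<lambda>_. Z"] allI gauss_span_square_integrable tendsto_L2_const)
qed

lemma chaos_scale:
  assumes X: "X \<in> first_wiener_chaos M N"
  shows "(\<lambda>\<omega>. t * X \<omega>) \<in> first_wiener_chaos M N"
proof -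
  obtain Z where "\<And>k. Z k \<in> gauss_span" "tendsto_L2 M Z X"
    using X unfolding chaos_iff_tendsto_L2 by blast
  then show ?thesis
    unfolding chaos_iff_tendsto_L2[of "\<lambda>\<omega>. t * X \<omega>"]
    by (intro conjI exI[of _ "\<lambda>k \<omega>. t * Z k \<omega>"] allI gauss_span_scale tendsto_L2_scale
        square_integrable_scale chaos_square_integrable X)
qed

lemma chaos_add:
  assumes X: "X \<in> first_wiener_chaos M N" and Y: "Y \<in> first_wiener_chaos M N"
  shows "(\<lambda>\<omega>. X \<omega> + Y \<omega>) \<in> first_wiener_chaos M N"
proof -
  obtain Z where Z: "\<And>k. Z k \<in> gauss_span" "tendsto_L2 M Z X"
    using X unfolding chaos_iff_tendsto_L2 by blast
  obtain Z' where Z': "\<And>k. Z' k \<in> gauss_span" "tendsto_L2 M Z' Y"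
    using Y unfolding chaos_iff_tendsto_L2 by blast
  note square_integrable = chaos_square_integrable[OF X] chaos_square_integrable[OF Y]
    gauss_span_square_integrable[OF Z(1)] gauss_span_square_integrable[OF Z'(1)]
  show ?thesis
    unfolding chaos_iff_tendsto_L2
    by (intro conjI exI[of _ "\<lambda>k \<omega>. Z k \<omega> + Z' k \<omega>"] allI gauss_span_add Z Z'
        square_integrable_add tendsto_L2_add square_integrable)
qed

lemma chaos_diff:
  assumes "X \<in> first_wiener_chaos M N" "Y \<in> first_wiener_chaos M N"
  shows "(\<lambda>\<omega>. X \<omega> - Y \<omega>) \<in> first_wiener_chaos M N"
  using chaos_add[OF assms(1) chaos_scale[OF assms(2), of "- 1"]] by simp

lemma chaos_sum:
  assumes "\<And>i. i \<in> I \<Longrightarrow> X i \<in> first_wiener_chaos M N"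
  shows "(\<lambda>\<omega>. \<Sum>i\<in>I. a i * X i \<omega>) \<in> first_wiener_chaos M N"
proof -
  have zero: "(\<lambda>_. 0) \<in> first_wiener_chaos M N"
    using gauss_span_subset_chaos gauss_span_zero by blast
  show ?thesis
    using assms
    by (induction I rule: infinite_finite_induct) (simp_all add: zero chaos_add chaos_scale)
qed

lemma chaos_family_approximation:
  fixes I :: "'i set"
  assumes I: "finite I" and Y: "\<And>i. i \<in> I \<Longrightarrow> Y i \<in> first_wiener_chaos M N"
  obtains Z where "\<And>i k. i \<in> I \<Longrightarrow> Z i k \<in> gauss_span"
    "\<And>i. i \<in> I \<Longrightarrow> tendsto_L2 M (Z i) (Y i)"
    "AE \<omega> in M. \<forall>i\<in>I. (\<lambda>k. Z i k \<omega>) \<longlonglongrightarrow> Y i \<omega>"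
proof -
  have "\<exists>Z. (\<forall>k. Z k \<in> gauss_span) \<and> tendsto_L2 M Z (Y i)" if "i \<in> I" for i
    using Y[OF that] unfolding chaos_iff_tendsto_L2 by blast
  then obtain Z where Z: "\<And>i k. i \<in> I \<Longrightarrow> Z i k \<in> gauss_span"
      "\<And>i. i \<in> I \<Longrightarrow> tendsto_L2 M (Z i) (Y i)"
    by metis
  obtain r :: "nat \<Rightarrow> nat" where r: "strict_mono r"
    and AE: "AE \<omega> in M. \<forall>i\<in>I. (\<lambda>k. Z i (r k) \<omega>) \<longlonglongrightarrow> Y i \<omega>"
    by (rule tendsto_L2_AE_subseq[of I M Z Y, OF I Z(2) gauss_span_square_integrable[OF Z(1)]
          chaos_square_integrable[OF Y]])
  have "tendsto_L2 M (\<lambda>k. Z i (r k)) (Y i)" if "i \<in> I" for i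
    using LIMSEQ_subseq_LIMSEQ[OF Z(2)[OF that, unfolded tendsto_L2_def] r]
    by (simp add: tendsto_L2_def o_def)
  with Z(1) AE show thesis
    by (intro that[of "\<lambda>i k. Z i (r k)"])
qed

end

section \<open>Negative moments of Gaussian quadratic forms\<close>

lemma bilinear_sum_le_hilbert_schmidt:
  fixes G :: "'i \<Rightarrow> 'i \<Rightarrow> real" and y :: "'i \<Rightarrow> real"
  shows "(\<Sum>i\<in>I. \<Sum>j\<in>I. G i j * (y i * y j)) \<le> sqrt (\<Sum>i\<in>I. \<Sum>j\<in>I. (G i j)\<^sup>2) * (\<Sum>i\<in>I. (y i)\<^sup>2)"
proof -
  have "(\<Sum>(i,j)\<in>I \<times> I. G i j * (y i * y j))\<^sup>2
      \<le> (\<Sum>(i,j)\<in>I \<times> I. (G i j)\<^sup>2) * (\<Sum>(i,j)\<in>I \<times> I. (y i * y j)\<^sup>2)"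
    using Cauchy_Schwarz_ineq_sum[of "\<lambda>(i,j). G i j" "\<lambda>(i,j). y i * y j" "I \<times> I"]
    by (simp add: case_prod_unfold)
  also have "(\<Sum>(i,j)\<in>I \<times> I. (y i * y j)\<^sup>2) = (\<Sum>i\<in>I. (y i)\<^sup>2)\<^sup>2"
    by (simp add: sum.cartesian_product[symmetric] power_mult_distrib sum_product
        power2_eq_square[of "sum _ _"])
  finally have "(\<Sum>i\<in>I. \<Sum>j\<in>I. G i j * (y i * y j))\<^sup>2
      \<le> (\<Sum>i\<in>I. \<Sum>j\<in>I. (G i j)\<^sup>2) * (\<Sum>i\<in>I. (y i)\<^sup>2)\<^sup>2"
    by (simp add: sum.cartesian_product)
  then have "\<bar>\<Sum>i\<in>I. \<Sum>j\<in>I. G i j * (y i * y j)\<bar>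
      \<le> sqrt ((\<Sum>i\<in>I. \<Sum>j\<in>I. (G i j)\<^sup>2) * (\<Sum>i\<in>I. (y i)\<^sup>2)\<^sup>2)"
    unfolding real_sqrt_abs[symmetric] by (rule real_sqrt_le_mono)
  also have "\<dots> = sqrt (\<Sum>i\<in>I. \<Sum>j\<in>I. (G i j)\<^sup>2) * (\<Sum>i\<in>I. (y i)\<^sup>2)"
    by (simp add: real_sqrt_mult sum_nonneg)
  finally show ?thesis by simp
qed

lemma nn_integral_inverse_power_le:
  fixes Q :: "'a \<Rightarrow> real"
  assumes [measurable]: "Q \<in> borel_measurable M" and Q: "\<And>x. 0 \<le> Q x"
    and bound: "\<And>\<delta>. 0 < \<delta> \<Longrightarrow> (\<integral>\<^sup>+x. ennreal (1 / (\<delta> + Q x) ^ m) \<partial>M) \<le> c"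
  shows "(\<integral>\<^sup>+x. inverse (ennreal (Q x)) ^ m \<partial>M) \<le> c"
proof -
  define u where "u k x = ennreal (1 / (inverse (real (Suc k)) + Q x) ^ m)" for k x
  have "(\<lambda>k. u k x) \<longlonglongrightarrow> inverse (ennreal (Q x)) ^ m" for x
  proof -
    have "(\<lambda>k. ennreal ((inverse (real (Suc k)) + Q x) ^ m)) \<longlonglongrightarrow> ennreal ((0 + Q x) ^ m)"
      by (intro tendsto_intros LIMSEQ_inverse_real_of_nat)
    then have "(\<lambda>k. inverse (ennreal ((inverse (real (Suc k)) + Q x) ^ m)))
        \<longlonglongrightarrow> inverse (ennreal ((0 + Q x) ^ m))"
      by (rule continuous_on_tendsto_compose
          [OF continuous_on_inverse_ennreal[OF continuous_on_id, of UNIV]]) simp_all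
    moreover have "inverse (ennreal ((inverse (real (Suc k)) + Q x) ^ m)) = u k x" for k
      using Q[of x] unfolding u_def
      by (subst inverse_ennreal) (simp_all add: add_pos_nonneg inverse_eq_divide)
    moreover have "inverse (ennreal ((0 + Q x) ^ m)) = inverse (ennreal (Q x)) ^ m"
      using Q[of x] by (simp add: ennreal_power[symmetric] ennreal_inverse_power)
    ultimately show ?thesis
      by simp
  qed
  then have "inverse (ennreal (Q x)) ^ m = liminf (\<lambda>k. u k x)" for x
    by (rule lim_imp_Liminf[OF trivial_limit_sequentially, symmetric])
  then have "(\<integral>\<^sup>+x. inverse (ennreal (Q x)) ^ m \<partial>M) = (\<integral>\<^sup>+x. liminf (\<lambda>k. u k x) \<partial>M)"
    by simp
  also have "\<dots> \<le> liminf (\<lambda>k. \<integral>\<^sup>+x. u k x \<partial>M)"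
    by (rule nn_integral_liminf) (simp add: u_def)
  also have "\<dots> \<le> c"
    using bound by (intro Liminf_le) (auto simp: u_def)
  finally show ?thesis .
qed

context prob_space
begin

definition covariance_form :: "'i set \<Rightarrow> ('i \<Rightarrow> 'a \<Rightarrow> real) \<Rightarrow> 'a \<Rightarrow> real" where
  "covariance_form I Y \<omega> = (\<Sum>i\<in>I. \<Sum>j\<in>I. expectation (\<lambda>\<omega>. Y i \<omega> * Y j \<omega>) * (Y i \<omega> * Y j \<omega>))"

definition hs_covariance :: "'i set \<Rightarrow> ('i \<Rightarrow> 'a \<Rightarrow> real) \<Rightarrow> real" where
  "hs_covariance I Y = sqrt (\<Sum>i\<in>I. \<Sum>j\<in>I. (expectation (\<lambda>\<omega>. Y i \<omega> * Y j \<omega>))\<^sup>2)"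

lemma hs_covariance_nonneg: "0 \<le> hs_covariance I Y"
  by (simp add: hs_covariance_def sum_nonneg)

lemma covariance_form_le: "covariance_form I Y \<omega> \<le> hs_covariance I Y * sum_squares I Y \<omega>"
  unfolding covariance_form_def hs_covariance_def sum_squares_def by (rule bilinear_sum_le_hilbert_schmidt)

lemma integrable_covariance_form:
  assumes "\<And>i. i \<in> I \<Longrightarrow> square_integrable M (Y i)"
  shows "integrable M (covariance_form I Y)"
  unfolding covariance_form_def[abs_def]
  by (intro Bochner_Integration.integrable_sum integrable_mult_right
      square_integrable_imp_integrable_mult assms)

lemma integrable_sum_squares:
  assumes "\<And>i. i \<in> I \<Longrightarrow> square_integrable M (Y i)"
  shows "integrable M (sum_squares I Y)"
  unfolding sum_squares_def[abs_def]
  by (intro Bochner_Integration.integrable_sum square_integrable_imp_integrable_square assms)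

lemma expectation_sum_squares:
  assumes "\<And>i. i \<in> I \<Longrightarrow> square_integrable M (Y i)"
  shows "expectation (sum_squares I Y) = (\<Sum>i\<in>I. expectation (\<lambda>\<omega>. (Y i \<omega>)\<^sup>2))"
  unfolding sum_squares_def[abs_def]
  by (intro Bochner_Integration.integral_sum square_integrable_imp_integrable_square assms)

lemma expectation_inverse_power_tendsto:
  fixes Q :: "'a \<Rightarrow> real" and Qs :: "nat \<Rightarrow> 'a \<Rightarrow> real"
  assumes [measurable]: "Q \<in> borel_measurable M" "\<And>k. Qs k \<in> borel_measurable M"
    and nonneg: "\<And>\<omega>. 0 \<le> Q \<omega>" "\<And>k \<omega>. 0 \<le> Qs k \<omega>"
    and lim: "AE \<omega> in M. (\<lambda>k. Qs k \<omega>) \<longlonglongrightarrow> Q \<omega>" and \<delta>: "0 < \<delta>"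
  shows "(\<lambda>k. expectation (\<lambda>\<omega>. 1 / (\<delta> + Qs k \<omega>) ^ n)) \<longlonglongrightarrow> expectation (\<lambda>\<omega>. 1 / (\<delta> + Q \<omega>) ^ n)"
proof (rule integral_dominated_convergence[where w = "\<lambda>_. 1 / \<delta> ^ n"])
  have "\<delta> + Q \<omega> \<noteq> 0" for \<omega>
    using \<delta> nonneg(1)[of \<omega>] by linarith
  then have "(\<lambda>k. 1 / (\<delta> + Qs k \<omega>) ^ n) \<longlonglongrightarrow> 1 / (\<delta> + Q \<omega>) ^ n" if "(\<lambda>k. Qs k \<omega>) \<longlonglongrightarrow> Q \<omega>" for \<omega>
    using that by (intro tendsto_intros) auto
  then show "AE \<omega> in M. (\<lambda>k. 1 / (\<delta> + Qs k \<omega>) ^ n) \<longlonglongrightarrow> 1 / (\<delta> + Q \<omega>) ^ n"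
    by (rule eventually_mono[OF lim])
  show "AE \<omega> in M. norm (1 / (\<delta> + Qs k \<omega>) ^ n) \<le> 1 / \<delta> ^ n" for k
    using \<delta> nonneg(2) by (intro AE_I2) (simp add: frac_le power_mono)
qed (simp_all add: assms)

end

context gaussian_sequence
begin

lemma gauss_span_energy_identity:
  fixes I :: "'i set"
  assumes \<psi>: "bounded_C1_nonneg \<psi> \<psi>'" and I: "finite I" and Y: "\<And>i. i \<in> I \<Longrightarrow> Y i \<in> gauss_span"
  defines "Q \<equiv> sum_squares I Y"
  shows "expectation (\<lambda>\<omega>. Q \<omega> * \<psi> (Q \<omega>)) = expectation Q * expectation (\<lambda>\<omega>. \<psi> (Q \<omega>))
    + 2 * expectation (\<lambda>\<omega>. covariance_form I Y \<omega> * \<psi>' (Q \<omega>))"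
proof -
  define \<Gamma> where "\<Gamma> i j = expectation (\<lambda>\<omega>. Y i \<omega> * Y j \<omega>)" for i j
  have Y_sq: "square_integrable M (Y i)" if "i \<in> I" for i
    using Y[OF that] by (rule gauss_span_square_integrable)
  have Q: "Q \<in> borel_measurable M" "\<And>\<omega>. 0 \<le> Q \<omega>"
    unfolding Q_def using integrable_sum_squares[of I Y] Y_sq by (auto simp: sum_squares_nonneg)
  have integrable_products: "integrable M (\<lambda>\<omega>. Y i \<omega> * Y j \<omega> * \<psi> (Q \<omega>))"
      "integrable M (\<lambda>\<omega>. Y i \<omega> * Y j \<omega> * \<psi>' (Q \<omega>))" if "i \<in> I" "j \<in> I" for i j
    by (intro integrable_mult_bounded_C1[OF \<psi> Q] square_integrable_imp_integrable_mult Y_sq that)+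
  have "expectation (\<lambda>\<omega>. Q \<omega> * \<psi> (Q \<omega>)) = (\<Sum>i\<in>I. expectation (\<lambda>\<omega>. Y i \<omega> * Y i \<omega> * \<psi> (Q \<omega>)))"
    using integrable_products by (simp add: Q_def sum_squares_def sum_distrib_right power2_eq_square)
  also have "\<dots> = (\<Sum>i\<in>I. \<Gamma> i i * expectation (\<lambda>\<omega>. \<psi> (Q \<omega>))
      + 2 * (\<Sum>j\<in>I. \<Gamma> i j * expectation (\<lambda>\<omega>. Y i \<omega> * Y j \<omega> * \<psi>' (Q \<omega>))))"
    unfolding \<Gamma>_def Q_def by (intro sum.cong refl stein_identity_gauss_span[OF \<psi> I] Y)
  also have "\<dots> = (\<Sum>i\<in>I. \<Gamma> i i) * expectation (\<lambda>\<omega>. \<psi> (Q \<omega>))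
      + 2 * (\<Sum>i\<in>I. \<Sum>j\<in>I. \<Gamma> i j * expectation (\<lambda>\<omega>. Y i \<omega> * Y j \<omega> * \<psi>' (Q \<omega>)))"
    by (simp add: sum.distrib sum_distrib_left sum_distrib_right)
  also have "(\<Sum>i\<in>I. \<Sum>j\<in>I. \<Gamma> i j * expectation (\<lambda>\<omega>. Y i \<omega> * Y j \<omega> * \<psi>' (Q \<omega>)))
      = expectation (\<lambda>\<omega>. covariance_form I Y \<omega> * \<psi>' (Q \<omega>))"
    using integrable_products by (simp add: covariance_form_def \<Gamma>_def sum_distrib_right mult.assoc)
  also have "(\<Sum>i\<in>I. \<Gamma> i i) = expectation Q"
    using expectation_sum_squares[of I Y] Y_sq by (simp add: Q_def \<Gamma>_def power2_eq_square)
  finally show ?thesis .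
qed

lemma gauss_span_inverse_moment_step:
  fixes I :: "'i set"
  assumes I: "finite I" and Y: "\<And>i. i \<in> I \<Longrightarrow> Y i \<in> gauss_span" and \<delta>: "0 < \<delta>"
  defines "Q \<equiv> sum_squares I Y"
  shows "(expectation Q - 2 * real (Suc m) * hs_covariance I Y) * expectation (\<lambda>\<omega>. 1 / (\<delta> + Q \<omega>) ^ Suc m)
      \<le> expectation (\<lambda>\<omega>. 1 / (\<delta> + Q \<omega>) ^ m)"
proof -
  define W where "W k \<omega> = 1 / (\<delta> + Q \<omega>) ^ k" for k \<omega>
  let ?G = "covariance_form I Y" and ?h = "hs_covariance I Y" and ?c = "2 * real (Suc m)"
  have Q_integrable: "integrable M Q" and G_integrable: "integrable M ?G"
    unfolding Q_def using Y gauss_span_square_integrable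
    by (auto intro: integrable_sum_squares integrable_covariance_form)
  have Q: "Q \<in> borel_measurable M" "\<And>\<omega>. 0 \<le> Q \<omega>"
    using Q_integrable by (auto simp: Q_def sum_squares_nonneg)
  have pos: "0 < \<delta> + Q \<omega>" for \<omega>
    using \<delta> Q(2)[of \<omega>] by linarith
  have W: "0 \<le> W k \<omega>" "(\<delta> + Q \<omega>) * W (Suc k) \<omega> = W k \<omega>" for k \<omega>
    using pos[of \<omega>] by (simp_all add: W_def)
  note \<psi> = bounded_C1_nonneg_inverse_power[OF \<delta>]
  have integrable_W: "integrable M (\<lambda>\<omega>. X \<omega> * W k \<omega>)" if "integrable M X" for X k
    unfolding W_def by (rule integrable_mult_bounded_C1(1)[OF \<psi> Q that])
  have "expectation (\<lambda>\<omega>. Q \<omega> * W (Suc m) \<omega>) = expectation Q * expectation (W (Suc m))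
      + 2 * expectation (\<lambda>\<omega>. ?G \<omega> * (- real (Suc m) * W (Suc (Suc m)) \<omega>))"
    using gauss_span_energy_identity[OF \<psi>[of "Suc m"] I Y] by (simp add: Q_def W_def[abs_def])
  also have "\<dots> = expectation Q * expectation (W (Suc m)) - ?c * expectation (\<lambda>\<omega>. ?G \<omega> * W (Suc (Suc m)) \<omega>)"
    unfolding mult.left_commute[of "?G _"] by (simp del: of_nat_Suc)
  finally have identity: "expectation Q * expectation (W (Suc m))
      = expectation (\<lambda>\<omega>. Q \<omega> * W (Suc m) \<omega>) + ?c * expectation (\<lambda>\<omega>. ?G \<omega> * W (Suc (Suc m)) \<omega>)"
    by simp
  have "?G \<omega> * W (Suc (Suc m)) \<omega> \<le> ?h * W (Suc m) \<omega>" for \<omega>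
  proof -
    have "?h * Q \<omega> \<le> ?h * (\<delta> + Q \<omega>)"
      using \<delta> by (intro mult_left_mono hs_covariance_nonneg) simp
    then have "?G \<omega> \<le> ?h * (\<delta> + Q \<omega>)"
      using covariance_form_le[of I Y \<omega>] by (simp add: Q_def)
    from mult_right_mono[OF this W(1)[of "Suc (Suc m)" \<omega>]] show ?thesis
      by (simp only: mult.assoc W(2))
  qed
  then have "expectation (\<lambda>\<omega>. ?G \<omega> * W (Suc (Suc m)) \<omega>) \<le> expectation (\<lambda>\<omega>. ?h * W (Suc m) \<omega>)"
    using integrable_W[OF G_integrable] integrable_W[of "\<lambda>_. 1" "Suc m"] by (intro integral_mono) auto
  then have "?c * expectation (\<lambda>\<omega>. ?G \<omega> * W (Suc (Suc m)) \<omega>) \<le> ?c * (?h * expectation (W (Suc m)))"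
    by (intro mult_left_mono) auto
  moreover have "Q \<omega> * W (Suc m) \<omega> \<le> W m \<omega>" for \<omega>
    unfolding W(2)[of \<omega> m, symmetric] using \<delta> W(1) by (intro mult_right_mono) auto
  then have "expectation (\<lambda>\<omega>. Q \<omega> * W (Suc m) \<omega>) \<le> expectation (W m)"
    using integrable_W[OF Q_integrable] integrable_W[of "\<lambda>_. 1" m] by (intro integral_mono) auto
  ultimately show ?thesis
    using identity unfolding W_def[symmetric] left_diff_distrib mult.assoc by linarith
qed

lemma chaos_inverse_moment_step:
  fixes I :: "'i set"
  assumes I: "finite I" and Y: "\<And>i. i \<in> I \<Longrightarrow> Y i \<in> first_wiener_chaos M N" and \<delta>: "0 < \<delta>"
  defines "Q \<equiv> sum_squares I Y"
  shows "(expectation Q - 2 * real (Suc m) * hs_covariance I Y) * expectation (\<lambda>\<omega>. 1 / (\<delta> + Q \<omega>) ^ Suc m)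
      \<le> expectation (\<lambda>\<omega>. 1 / (\<delta> + Q \<omega>) ^ m)"
proof -
  obtain Z where Z: "\<And>i k. i \<in> I \<Longrightarrow> Z i k \<in> gauss_span"
    "\<And>i. i \<in> I \<Longrightarrow> tendsto_L2 M (Z i) (Y i)"
    and AE: "AE \<omega> in M. \<forall>i\<in>I. (\<lambda>k. Z i k \<omega>) \<longlonglongrightarrow> Y i \<omega>"
    using chaos_family_approximation[of I Y] I Y by blast
  define Zs where "Zs k i = Z i k" for k i
  let ?Q = "\<lambda>k. sum_squares I (Zs k)"
  have square_integrable_Y_Zs: "square_integrable M (Y i)" "square_integrable M (Zs k i)" if "i \<in> I" for i k
    using that by (auto simp: Zs_def chaos_square_integrable Y gauss_span_square_integrable Z)
  have covariance_limit: "(\<lambda>k. expectation (\<lambda>\<omega>. Zs k i \<omega> * Zs k j \<omega>)) \<longlonglongrightarrow> expectation (\<lambda>\<omega>. Y i \<omega> * Y j \<omega>)"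
    if "i \<in> I" "j \<in> I" for i j
    using that Z(2) square_integrable_Y_Zs unfolding Zs_def by (intro tendsto_L2_integral_mult) auto
  then have hs_limit: "(\<lambda>k. hs_covariance I (Zs k)) \<longlonglongrightarrow> hs_covariance I Y"
    unfolding hs_covariance_def by (intro tendsto_real_sqrt tendsto_sum tendsto_power)
  have mean_limit: "(\<lambda>k. expectation (?Q k)) \<longlonglongrightarrow> expectation Q"
    using covariance_limit unfolding Q_def
    by (simp add: expectation_sum_squares square_integrable_Y_Zs power2_eq_square tendsto_sum)
  have "AE \<omega> in M. (\<lambda>k. ?Q k \<omega>) \<longlonglongrightarrow> Q \<omega>"
    unfolding Q_def sum_squares_def Zs_def by (rule eventually_mono[OF AE]) (intro tendsto_intros, simp)
  then have inverse_moment: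
    "(\<lambda>k. expectation (\<lambda>\<omega>. 1 / (\<delta> + ?Q k \<omega>) ^ n)) \<longlonglongrightarrow> expectation (\<lambda>\<omega>. 1 / (\<delta> + Q \<omega>) ^ n)" for n
    unfolding Q_def using \<delta> square_integrable_Y_Zs
    by (intro expectation_inverse_power_tendsto borel_measurable_sum_squares
        square_integrable_measurable sum_squares_nonneg)
  let ?lhs = "\<lambda>Y Q. (expectation Q - 2 * real (Suc m) * hs_covariance I Y)
      * expectation (\<lambda>\<omega>. 1 / (\<delta> + Q \<omega>) ^ Suc m)"
  have "(\<lambda>k. ?lhs (Zs k) (?Q k)) \<longlonglongrightarrow> ?lhs Y Q"
    by (intro tendsto_intros mean_limit hs_limit inverse_moment)
  moreover have "?lhs (Zs k) (?Q k) \<le> expectation (\<lambda>\<omega>. 1 / (\<delta> + ?Q k \<omega>) ^ m)" for k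
    using Z(1) unfolding Zs_def by (intro gauss_span_inverse_moment_step I \<delta>)
  ultimately show ?thesis
    by (intro LIMSEQ_le[OF _ inverse_moment]) auto
qed

lemma chaos_negative_moment:
  fixes I :: "'i set"
  assumes I: "finite I" and Y: "\<And>i. i \<in> I \<Longrightarrow> Y i \<in> first_wiener_chaos M N"
  defines "Q \<equiv> sum_squares I Y"
  assumes mean: "0 < expectation Q" "4 * real m * hs_covariance I Y \<le> expectation Q"
  shows "(\<integral>\<^sup>+\<omega>. inverse (ennreal (Q \<omega>)) ^ m \<partial>M) \<le> ennreal ((2 / expectation Q) ^ m)"
proof (rule nn_integral_inverse_power_le)
  have Y_sq: "square_integrable M (Y i)" if "i \<in> I" for i
    using Y[OF that] by (rule chaos_square_integrable)
  then show Q_measurable [measurable]: "Q \<in> borel_measurable M"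
    unfolding Q_def by (intro borel_measurable_sum_squares square_integrable_measurable)
  show Q_nonneg: "0 \<le> Q \<omega>" for \<omega>
    by (simp add: Q_def sum_squares_nonneg)
  fix \<delta> :: real assume \<delta>: "0 < \<delta>"
  have "expectation (\<lambda>\<omega>. 1 / (\<delta> + Q \<omega>) ^ k) \<le> (2 / expectation Q) ^ k" if "k \<le> m" for k
    using that
  proof (induction k)
    case (Suc k)
    let ?E = "\<lambda>k. expectation (\<lambda>\<omega>. 1 / (\<delta> + Q \<omega>) ^ k)"
    have "4 * real (Suc k) * hs_covariance I Y \<le> expectation Q"
      using Suc.prems hs_covariance_nonneg[of I Y]
        mult_right_mono[of "4 * real (Suc k)" "4 * real m" "hs_covariance I Y"] mean(2) by simp
    then have "expectation Q / 2 * ?E (Suc k)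
        \<le> (expectation Q - 2 * real (Suc k) * hs_covariance I Y) * ?E (Suc k)"
      using \<delta> Q_nonneg by (intro mult_right_mono) (auto simp del: of_nat_Suc)
    also have "\<dots> \<le> ?E k"
      unfolding Q_def by (rule chaos_inverse_moment_step[OF I Y \<delta>])
    also have "\<dots> \<le> (2 / expectation Q) ^ k"
      using Suc by simp
    finally show ?case
      using mean(1) by (simp add: field_simps)
  qed (simp add: prob_space)
  then have "ennreal (expectation (\<lambda>\<omega>. 1 / (\<delta> + Q \<omega>) ^ m)) \<le> ennreal ((2 / expectation Q) ^ m)"
    by (intro ennreal_leI) simp
  moreover have "integrable M (\<lambda>\<omega>. 1 * (1 / (\<delta> + Q \<omega>) ^ m))"
    by (rule integrable_mult_bounded_C1[OF bounded_C1_nonneg_inverse_power[OF \<delta>] Q_measurable Q_nonneg]) simp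
  ultimately show "(\<integral>\<^sup>+\<omega>. ennreal (1 / (\<delta> + Q \<omega>) ^ m) \<partial>M) \<le> ennreal ((2 / expectation Q) ^ m)"
    using \<delta> Q_nonneg by (subst nn_integral_eq_integral) auto
qed

end

section \<open>Moments in the first Wiener chaos\<close>

lemma (in prob_space) char_distr:
  assumes "X \<in> borel_measurable M"
  shows "char (distr M borel X) t = (CLINT \<omega>|M. iexp (t * X \<omega>))"
  unfolding char_def using assms by (subst integral_distr) auto

lemma weighted_power_mean:
  fixes w y :: "'i \<Rightarrow> real"
  assumes I: "finite I" "I \<noteq> {}" and w: "\<And>i. i \<in> I \<Longrightarrow> 0 < w i" and y: "\<And>i. i \<in> I \<Longrightarrow> 0 \<le> y i"
  shows "(\<Sum>i\<in>I. y i) ^ k \<le> sum w I ^ k * (\<Sum>i\<in>I. w i / sum w I * (y i / w i) ^ k)"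
proof -
  have S: "0 < sum w I"
    using I w by (intro sum_pos)
  have "convex_on {0::real..} (\<lambda>x. x ^ k)"
    by (cases "even k") (auto intro: convex_power_odd convex_on_subset[OF convex_power_even])
  moreover have "(\<Sum>i\<in>I. w i / sum w I) = 1"
    using S by (simp add: sum_divide_distrib[symmetric])
  ultimately have "(\<Sum>i\<in>I. (w i / sum w I) *\<^sub>R (y i / w i)) ^ k \<le> (\<Sum>i\<in>I. w i / sum w I * (y i / w i) ^ k)"
    using I w y S by (intro convex_on_sum) (auto intro: divide_nonneg_pos less_imp_le)
  then have "(sum w I * (\<Sum>i\<in>I. (w i / sum w I) *\<^sub>R (y i / w i))) ^ k
      \<le> sum w I ^ k * (\<Sum>i\<in>I. w i / sum w I * (y i / w i) ^ k)"
    using S by (simp add: power_mult_distrib)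
  also have "sum w I * (\<Sum>i\<in>I. (w i / sum w I) *\<^sub>R (y i / w i)) = (\<Sum>i\<in>I. y i)"
    using S w[THEN less_imp_neq] by (auto simp: sum_distrib_left intro!: sum.cong)
  finally show ?thesis .
qed

context gaussian_sequence
begin

lemma char_gauss_span:
  assumes "Z \<in> gauss_span"
  shows "char (distr M borel Z) t = exp (- (t * L2_norm M Z)\<^sup>2 / 2)"
proof -
  obtain m c where form: "Z = (\<lambda>\<omega>. linear_form m c (\<lambda>l. N l \<omega>))"
    using assms by (auto simp: gauss_span_def)
  then have Z: "Z = (\<lambda>\<omega>. \<Sum>l<m. c l * N l \<omega>)"
    by (simp add: linear_form_def)
  have norm: "(L2_norm M Z)\<^sup>2 = (\<Sum>l<m. (c l)\<^sup>2)"
    unfolding form L2_norm_power2 unfolding power2_eq_square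
    by (rule expectation_linear_form_mult_linear_form)
  have indep_terms: "indep_vars (\<lambda>_. borel) (\<lambda>l \<omega>. c l * N l \<omega>) {..<m}"
    by (rule indep_vars_compose2[OF indep_vars_subset[OF indep]]) auto
  have "char (distr M borel (\<lambda>\<omega>. c l * N l \<omega>)) t = exp (- ((t * c l)\<^sup>2) / 2)" for l
    using char_std_normal_distribution char_distr[of "N l" "t * c l"]
    by (simp add: char_distr distr_N mult.assoc)
  then have "char (distr M borel Z) t = (\<Prod>l<m. complex_of_real (exp (- ((t * c l)\<^sup>2) / 2)))"
    unfolding Z by (subst char_distr_sum[OF indep_terms]) simp
  also have "\<dots> = complex_of_real (exp (\<Sum>l<m. - ((t * c l)\<^sup>2) / 2))"
    by (simp add: exp_sum)
  also have "(\<Sum>l<m. - ((t * c l)\<^sup>2) / 2) = - (t * L2_norm M Z)\<^sup>2 / 2"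
    by (simp add: norm sum_negf sum_divide_distrib[symmetric] power_mult_distrib sum_distrib_left)
  finally show ?thesis .
qed

lemma char_chaos:
  assumes X: "X \<in> first_wiener_chaos M N"
  shows "char (distr M borel X) t = exp (- (t * L2_norm M X)\<^sup>2 / 2)"
proof -
  obtain Z where Z: "\<And>k. Z k \<in> gauss_span" "tendsto_L2 M Z X"
    and AE: "AE \<omega> in M. (\<lambda>k. Z k \<omega>) \<longlonglongrightarrow> X \<omega>"
    using chaos_family_approximation[of "{()}" "\<lambda>_. X"] X by auto
  note [measurable] = chaos_measurable[OF X]
    square_integrable_measurable[OF gauss_span_square_integrable[OF Z(1)]]
  have "(\<lambda>k. char (distr M borel (Z k)) t) \<longlonglongrightarrow> char (distr M borel X) t"
    unfolding char_distr[OF chaos_measurable[OF X]]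
      char_distr[OF square_integrable_measurable[OF gauss_span_square_integrable[OF Z(1)]]]
  proof (rule integral_dominated_convergence[where w = "\<lambda>_. 1"])
    show "AE \<omega> in M. (\<lambda>k. iexp (t * Z k \<omega>)) \<longlonglongrightarrow> iexp (t * X \<omega>)"
      by (rule eventually_mono[OF AE]) (intro tendsto_intros)
  qed auto
  moreover have "(\<lambda>k. expectation (\<lambda>\<omega>. Z k \<omega> * Z k \<omega>)) \<longlonglongrightarrow> expectation (\<lambda>\<omega>. X \<omega> * X \<omega>)"
    by (intro tendsto_L2_integral_mult Z chaos_square_integrable X gauss_span_square_integrable)
  then have "(\<lambda>k. L2_norm M (Z k)) \<longlonglongrightarrow> L2_norm M X"
    unfolding L2_norm_def power2_eq_square by (rule tendsto_real_sqrt)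
  then have "(\<lambda>k. char (distr M borel (Z k)) t) \<longlonglongrightarrow> exp (- (t * L2_norm M X)\<^sup>2 / 2)"
    unfolding char_gauss_span[OF Z(1)] by (intro tendsto_intros) auto
  ultimately show ?thesis
    by (rule LIMSEQ_unique)
qed

lemma distr_chaos:
  assumes X: "X \<in> first_wiener_chaos M N"
  shows "distr M borel X = distr std_normal_distribution borel (\<lambda>x. L2_norm M X * x)"
proof (rule Levy_uniqueness)
  interpret S: real_distribution std_normal_distribution
    by (rule real_dist_normal_dist)
  show "real_distribution (distr M borel X)"
    using chaos_measurable[OF X] by (rule real_distribution_distr)
  show "real_distribution (distr std_normal_distribution borel (\<lambda>x. L2_norm M X * x))"
    by (rule S.real_distribution_distr) simp
  have "char (distr std_normal_distribution borel (\<lambda>x. L2_norm M X * x)) t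
      = char std_normal_distribution (t * L2_norm M X)" for t
    unfolding char_def by (subst integral_distr) (auto simp: mult_ac)
  then show "char (distr M borel X) = char (distr std_normal_distribution borel (\<lambda>x. L2_norm M X * x))"
    by (simp add: fun_eq_iff char_chaos[OF X] char_std_normal_distribution)
qed

lemma chaos_even_moment:
  assumes X: "X \<in> first_wiener_chaos M N"
  shows "has_bochner_integral M (\<lambda>\<omega>. X \<omega> ^ (2 * k))
    (fact (2 * k) / (2 ^ k * fact k) * expectation (\<lambda>\<omega>. (X \<omega>)\<^sup>2) ^ k)"
proof -
  note [measurable] = chaos_measurable[OF X]
  define c where "c = fact (2 * k) / (2 ^ k * fact k) * expectation (\<lambda>\<omega>. (X \<omega>)\<^sup>2) ^ k"
  have "has_bochner_integral lborel
      (\<lambda>x. L2_norm M X ^ (2 * k) * (std_normal_density x * x ^ (2 * k)))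
      (L2_norm M X ^ (2 * k) * (fact (2 * k) / (2 ^ k * fact k)))"
    by (intro has_bochner_integral_mult_right std_normal_moment_even)
  moreover have "L2_norm M X ^ (2 * k) = expectation (\<lambda>\<omega>. (X \<omega>)\<^sup>2) ^ k"
    by (simp only: power_mult L2_norm_power2)
  ultimately have "has_bochner_integral lborel
      (\<lambda>x. std_normal_density x *\<^sub>R (L2_norm M X * x) ^ (2 * k)) c"
    unfolding c_def power_mult_distrib by (simp add: mult_ac)
  then have "has_bochner_integral std_normal_distribution (\<lambda>x. (L2_norm M X * x) ^ (2 * k)) c"
    by (intro has_bochner_integral_density) auto
  then have "has_bochner_integral (distr M borel X) (\<lambda>y. y ^ (2 * k)) c"
    unfolding distr_chaos[OF X] by (intro has_bochner_integral_distr) auto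
  then show ?thesis
    unfolding c_def[symmetric] has_bochner_integral_iff
    by (auto simp: integrable_distr_eq integral_distr)
qed

lemma chaos_product_of_squares:
  assumes X: "X \<in> first_wiener_chaos M N" and Y: "Y \<in> first_wiener_chaos M N"
  shows "has_bochner_integral M (\<lambda>\<omega>. (X \<omega>)\<^sup>2 * (Y \<omega>)\<^sup>2)
    (expectation (\<lambda>\<omega>. (X \<omega>)\<^sup>2) * expectation (\<lambda>\<omega>. (Y \<omega>)\<^sup>2) + 2 * (expectation (\<lambda>\<omega>. X \<omega> * Y \<omega>))\<^sup>2)"
proof -
  let ?a = "expectation (\<lambda>\<omega>. (X \<omega>)\<^sup>2)" and ?b = "expectation (\<lambda>\<omega>. (Y \<omega>)\<^sup>2)"
    and ?c = "expectation (\<lambda>\<omega>. X \<omega> * Y \<omega>)"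
  have fourth: "has_bochner_integral M (\<lambda>\<omega>. Z \<omega> ^ 4) (3 * (expectation (\<lambda>\<omega>. (Z \<omega>)\<^sup>2))\<^sup>2)"
    if "Z \<in> first_wiener_chaos M N" for Z
    using chaos_even_moment[OF that, of 2] by (simp add: fact_numeral)
  note integrable = chaos_square_integrable[OF X, THEN square_integrable_imp_integrable_square]
    chaos_square_integrable[OF Y, THEN square_integrable_imp_integrable_square]
    square_integrable_imp_integrable_mult[OF chaos_square_integrable[OF X] chaos_square_integrable[OF Y]]
  have square_add: "expectation (\<lambda>\<omega>. (X \<omega> + Y \<omega>)\<^sup>2) = ?a + ?b + 2 * ?c"
    and square_diff: "expectation (\<lambda>\<omega>. (X \<omega> - Y \<omega>)\<^sup>2) = ?a + ?b - 2 * ?c"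
    using integrable by (simp_all add: power2_sum power2_diff mult.assoc)
  have "has_bochner_integral M
      (\<lambda>\<omega>. 1 / 12 * ((X \<omega> + Y \<omega>) ^ 4 + (X \<omega> - Y \<omega>) ^ 4 - 2 * X \<omega> ^ 4 - 2 * Y \<omega> ^ 4))
      (1 / 12 * (3 * (?a + ?b + 2 * ?c)\<^sup>2 + 3 * (?a + ?b - 2 * ?c)\<^sup>2
        - 2 * (3 * ?a\<^sup>2) - 2 * (3 * ?b\<^sup>2)))"
    using fourth[OF chaos_add[OF X Y]] fourth[OF chaos_diff[OF X Y]] fourth[OF X] fourth[OF Y]
    unfolding square_add square_diff
    by (intro has_bochner_integral_mult_right has_bochner_integral_diff has_bochner_integral_add)
  moreover have "1 / 12 * ((x + y) ^ 4 + (x - y) ^ 4 - 2 * x ^ 4 - 2 * y ^ 4) = x\<^sup>2 * y\<^sup>2" for x y :: real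
    by (simp add: power4_eq_xxxx power2_eq_square algebra_simps)
  moreover have "1 / 12 * (3 * (?a + ?b + 2 * ?c)\<^sup>2 + 3 * (?a + ?b - 2 * ?c)\<^sup>2
        - 2 * (3 * ?a\<^sup>2) - 2 * (3 * ?b\<^sup>2))
      = ?a * ?b + 2 * ?c\<^sup>2"
    by (simp add: power2_eq_square algebra_simps)
  ultimately show ?thesis
    by (simp only:)
qed

lemma chaos_sum_squares_variance:
  fixes I :: "'i set"
  assumes Y: "\<And>i. i \<in> I \<Longrightarrow> Y i \<in> first_wiener_chaos M N"
  shows "square_integrable M (sum_squares I Y)"
    and "variance (sum_squares I Y) = 2 * (hs_covariance I Y)\<^sup>2"
proof -
  define Q where "Q = sum_squares I Y"
  have Y_sq: "square_integrable M (Y i)" if "i \<in> I" for i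
    using Y[OF that] by (rule chaos_square_integrable)
  have Q: "integrable M Q" and mean: "expectation Q = (\<Sum>i\<in>I. expectation (\<lambda>\<omega>. (Y i \<omega>)\<^sup>2))"
    unfolding Q_def using Y_sq by (auto intro: integrable_sum_squares expectation_sum_squares)
  have "has_bochner_integral M (\<lambda>\<omega>. \<Sum>i\<in>I. \<Sum>j\<in>I. (Y i \<omega>)\<^sup>2 * (Y j \<omega>)\<^sup>2)
      (\<Sum>i\<in>I. \<Sum>j\<in>I. expectation (\<lambda>\<omega>. (Y i \<omega>)\<^sup>2) * expectation (\<lambda>\<omega>. (Y j \<omega>)\<^sup>2)
        + 2 * (expectation (\<lambda>\<omega>. Y i \<omega> * Y j \<omega>))\<^sup>2)"
    by (intro has_bochner_integral_sum chaos_product_of_squares Y)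
  moreover have "(Q \<omega>)\<^sup>2 = (\<Sum>i\<in>I. \<Sum>j\<in>I. (Y i \<omega>)\<^sup>2 * (Y j \<omega>)\<^sup>2)" for \<omega>
    by (simp add: Q_def sum_squares_def power2_eq_square[of "sum _ _"] sum_product)
  moreover have "(\<Sum>i\<in>I. \<Sum>j\<in>I. expectation (\<lambda>\<omega>. (Y i \<omega>)\<^sup>2) * expectation (\<lambda>\<omega>. (Y j \<omega>)\<^sup>2)
        + 2 * (expectation (\<lambda>\<omega>. Y i \<omega> * Y j \<omega>))\<^sup>2) = (expectation Q)\<^sup>2 + 2 * (hs_covariance I Y)\<^sup>2"
    unfolding mean power2_eq_square[of "sum _ _"] sum_product
    by (simp add: hs_covariance_def sum.distrib sum_distrib_left sum_nonneg)
  ultimately have square: "has_bochner_integral M (\<lambda>\<omega>. (Q \<omega>)\<^sup>2)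
      ((expectation Q)\<^sup>2 + 2 * (hs_covariance I Y)\<^sup>2)"
    by simp
  then show "square_integrable M (sum_squares I Y)"
    using Q by (simp add: square_integrable_def has_bochner_integral_iff Q_def)
  show "variance (sum_squares I Y) = 2 * (hs_covariance I Y)\<^sup>2"
    using square Q variance_eq[of Q] by (simp add: has_bochner_integral_iff Q_def)
qed

lemma chaos_sum_squares_moment_weighted:
  fixes I :: "'i set" and k :: nat
  assumes I: "finite I" "I \<noteq> {}" and Y: "\<And>i. i \<in> I \<Longrightarrow> Y i \<in> first_wiener_chaos M N"
    and w: "\<And>i. i \<in> I \<Longrightarrow> 0 < w i" "\<And>i. i \<in> I \<Longrightarrow> expectation (\<lambda>\<omega>. (Y i \<omega>)\<^sup>2) \<le> w i"
  shows "integrable M (\<lambda>\<omega>. sum_squares I Y \<omega> ^ k)"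
    and "expectation (\<lambda>\<omega>. sum_squares I Y \<omega> ^ k) \<le> fact (2 * k) / (2 ^ k * fact k) * sum w I ^ k"
proof -
  define C :: real where "C = fact (2 * k) / (2 ^ k * fact k)"
  define v where "v i = expectation (\<lambda>\<omega>. (Y i \<omega>)\<^sup>2)" for i
  define b where "b \<omega> = sum w I ^ k * (\<Sum>i\<in>I. w i / sum w I * ((Y i \<omega>)\<^sup>2 / w i) ^ k)" for \<omega>
  have S: "0 < sum w I"
    using I w(1) by (intro sum_pos)
  have [measurable]: "sum_squares I Y \<in> borel_measurable M"
    by (intro borel_measurable_sum_squares chaos_measurable Y)
  have le_b: "sum_squares I Y \<omega> ^ k \<le> b \<omega>" for \<omega>
    unfolding sum_squares_def b_def by (intro weighted_power_mean I w) auto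
  have term_eq: "((Y i \<omega>)\<^sup>2 / w i) ^ k = inverse (w i ^ k) * Y i \<omega> ^ (2 * k)" for i \<omega>
    by (simp add: divide_inverse power_mult_distrib power_inverse power_mult[symmetric] mult.commute)
  have b: "has_bochner_integral M b
      (sum w I ^ k * (\<Sum>i\<in>I. w i / sum w I * (inverse (w i ^ k) * (C * v i ^ k))))"
    unfolding b_def term_eq C_def v_def
    by (intro has_bochner_integral_mult_right has_bochner_integral_sum chaos_even_moment Y)
  have "norm (sum_squares I Y \<omega> ^ k) \<le> norm (b \<omega>)" for \<omega>
    using le_b[of \<omega>] zero_le_power[OF sum_squares_nonneg[of I Y \<omega>], of k]
    unfolding real_norm_def by linarith
  then show integrable: "integrable M (\<lambda>\<omega>. sum_squares I Y \<omega> ^ k)"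
    by (intro Bochner_Integration.integrable_bound[OF integrable.intros[OF b]] AE_I2) measurable
  have "inverse (w i ^ k) * (C * v i ^ k) \<le> C" if "i \<in> I" for i
  proof -
    have "C * (v i / w i) ^ k \<le> C * 1"
      using w[OF that] by (intro mult_left_mono power_le_one) (auto simp: C_def v_def)
    then show ?thesis
      by (simp add: divide_inverse power_mult_distrib power_inverse mult_ac)
  qed
  then have "(\<Sum>i\<in>I. w i / sum w I * (inverse (w i ^ k) * (C * v i ^ k))) \<le> (\<Sum>i\<in>I. w i / sum w I * C)"
    using w(1) S by (intro sum_mono mult_left_mono) (auto intro: less_imp_le)
  also have "\<dots> = C"
    using S by (simp add: sum_distrib_right[symmetric] sum_divide_distrib[symmetric])
  finally have "integral\<^sup>L M b \<le> sum w I ^ k * C"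
    unfolding has_bochner_integral_integral_eq[OF b] using S by (intro mult_left_mono) auto
  moreover have "expectation (\<lambda>\<omega>. sum_squares I Y \<omega> ^ k) \<le> integral\<^sup>L M b"
    by (intro integral_mono integrable integrable.intros[OF b] le_b)
  ultimately show "expectation (\<lambda>\<omega>. sum_squares I Y \<omega> ^ k) \<le> fact (2 * k) / (2 ^ k * fact k) * sum w I ^ k"
    by (simp add: C_def mult.commute)
qed

lemma chaos_sum_squares_moment:
  fixes I :: "'i set" and k :: nat
  assumes I: "finite I" and Y: "\<And>i. i \<in> I \<Longrightarrow> Y i \<in> first_wiener_chaos M N"
  defines "Q \<equiv> sum_squares I Y"
  shows "integrable M (\<lambda>\<omega>. Q \<omega> ^ k)"
    and "expectation (\<lambda>\<omega>. Q \<omega> ^ k) \<le> fact (2 * k) / (2 ^ k * fact k) * expectation Q ^ k"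
proof -
  let ?C = "fact (2 * k) / (2 ^ k * fact k) :: real" and ?v = "\<lambda>i. expectation (\<lambda>\<omega>. (Y i \<omega>)\<^sup>2)"
  have bound: "integrable M (\<lambda>\<omega>. Q \<omega> ^ k) \<and> expectation (\<lambda>\<omega>. Q \<omega> ^ k) \<le> ?C * (\<Sum>i\<in>I. ?v i + \<epsilon>) ^ k"
    if "0 < \<epsilon>" for \<epsilon>
  proof (cases "I = {}")
    case True
    then show ?thesis
      by (cases k) (auto simp: Q_def sum_squares_def prob_space)
  next
    case False
    then show ?thesis
      unfolding Q_def using that I Y
        chaos_sum_squares_moment_weighted[of I Y "\<lambda>i. ?v i + \<epsilon>" k] by (simp add: add_nonneg_pos)
  qed
  then show "integrable M (\<lambda>\<omega>. Q \<omega> ^ k)"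
    using zero_less_one by blast
  have "((\<lambda>\<epsilon>. ?C * (\<Sum>i\<in>I. ?v i + \<epsilon>) ^ k) \<longlongrightarrow> ?C * (\<Sum>i\<in>I. ?v i + 0) ^ k) (at_right 0)"
    by (intro tendsto_intros)
  then have "expectation (\<lambda>\<omega>. Q \<omega> ^ k) \<le> ?C * (\<Sum>i\<in>I. ?v i + 0) ^ k"
    by (rule tendsto_lowerbound) (use bound in \<open>auto simp: eventually_at_right_field intro: exI[of _ 1]\<close>)
  then show "expectation (\<lambda>\<omega>. Q \<omega> ^ k) \<le> ?C * expectation Q ^ k"
    using expectation_sum_squares[of I Y] Y chaos_square_integrable by (simp add: Q_def)
qed

end

section \<open>The minimal Rayleigh quotient of a matrix\<close>

lemma norm_matrix_vector_mult_le:
  fixes A :: "real^'n^'m"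
  shows "norm (A *v x) \<le> norm A * norm x"
proof -
  have "norm (A *v x) = L2_set (\<lambda>i. norm (inner (A $ i) x)) UNIV"
    by (simp add: norm_vec_def[of "A *v x"] matrix_vector_mul_component)
  also have "\<dots> \<le> L2_set (\<lambda>i. norm (A $ i) * norm x) UNIV"
    by (intro L2_set_mono) (auto simp: Cauchy_Schwarz_ineq2)
  also have "\<dots> = norm A * norm x"
    by (simp add: norm_vec_def[of A] L2_set_left_distrib[symmetric])
  finally show ?thesis .
qed

lemma abs_inner_matrix_vector_le:
  fixes A :: "real^'n^'n"
  shows "\<bar>x \<bullet> (A *v x)\<bar> \<le> norm A * (norm x)\<^sup>2"
  using Cauchy_Schwarz_ineq2[of x "A *v x"]
    mult_left_mono[OF norm_matrix_vector_mult_le[of A x] norm_ge_zero[of x]]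
  by (simp add: power2_eq_square mult_ac)

lemma norm_le_card_mult_onorm:
  fixes A :: "real^'n^'n"
  shows "norm A \<le> (real CARD('n))\<^sup>2 * onorm ((*v) A)"
proof -
  have "norm A \<le> (\<Sum>i\<in>UNIV. norm (A $ i))"
    unfolding norm_vec_def[of A] by (rule L2_set_le_sum) simp
  also have "\<dots> \<le> (\<Sum>i\<in>(UNIV::'n set). \<Sum>j\<in>(UNIV::'n set). onorm ((*v) A))"
    by (intro sum_mono order_trans[OF norm_le_l1_cart] matrix_component_le_onorm)
  finally show ?thesis
    by (simp add: power2_eq_square)
qed

lemma abs_det_le_onorm:
  fixes A :: "real^'n^'n"
  shows "\<bar>det A\<bar> \<le> fact CARD('n) * onorm ((*v) A) ^ CARD('n)"
proof -
  have "\<bar>det A\<bar> \<le> (\<Sum>p | p permutes (UNIV::'n set). \<bar>of_int (sign p) * (\<Prod>i\<in>UNIV. A $ i $ p i)\<bar>)"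
    unfolding det_def by (rule sum_abs)
  also have "\<dots> \<le> (\<Sum>p | p permutes (UNIV::'n set). onorm ((*v) A) ^ CARD('n))"
  proof (rule sum_mono)
    fix p :: "'n \<Rightarrow> 'n"
    have "\<bar>of_int (sign p) * (\<Prod>i\<in>UNIV. A $ i $ p i)\<bar> = (\<Prod>i\<in>UNIV. \<bar>A $ i $ p i\<bar>)"
      by (simp add: abs_mult abs_prod sign_def)
    also have "\<dots> \<le> (\<Prod>i\<in>(UNIV::'n set). onorm ((*v) A))"
      by (intro prod_mono) (use matrix_component_le_onorm in auto)
    finally show "\<bar>of_int (sign p) * (\<Prod>i\<in>UNIV. A $ i $ p i)\<bar> \<le> onorm ((*v) A) ^ CARD('n)"
      by simp
  qed
  also have "\<dots> = fact CARD('n) * onorm ((*v) A) ^ CARD('n)"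
    by (simp add: card_permutations)
  finally show ?thesis .
qed

lemma trace_le_card_mult_norm:
  fixes A :: "real^'n^'n"
  shows "trace A \<le> real CARD('n) * norm A"
proof -
  have "A $ i $ i \<le> norm A" for i
    using component_le_norm_cart[of "A $ i" i] Finite_Cartesian_Product.norm_nth_le[of A i] by linarith
  then have "trace A \<le> (\<Sum>i\<in>(UNIV::'n set). norm A)"
    unfolding trace_def by (intro sum_mono)
  then show ?thesis
    by simp
qed

lemma matrix_inv_inverse:
  fixes A :: "real^'n^'n"
  assumes "invertible A"
  shows matrix_inv_right: "A ** matrix_inv A = mat 1" and matrix_inv_left: "matrix_inv A ** A = mat 1"
  using someI_ex[OF assms[unfolded invertible_def]] by (simp_all add: matrix_inv_def)

definition min_rayleigh :: "real^'n^'n \<Rightarrow> real" where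
  "min_rayleigh A = (INF v\<in>sphere 0 1. v \<bullet> (A *v v))"

lemma min_rayleigh_attained:
  fixes A :: "real^'n^'n"
  obtains v where "norm v = 1" "v \<bullet> (A *v v) = min_rayleigh A"
proof -
  have "sphere (0::real^'n) 1 \<noteq> {}"
    using vector_choose_size[of 1, where 'a = "real^'n"] by auto
  moreover have "continuous_on (sphere 0 1) (\<lambda>v. v \<bullet> (A *v v))"
    by (intro continuous_intros)
  ultimately obtain v where v: "v \<in> sphere 0 1" "\<And>w. w \<in> sphere 0 1 \<Longrightarrow> v \<bullet> (A *v v) \<le> w \<bullet> (A *v w)"
    using continuous_attains_inf[OF compact_sphere] by blast
  then have "min_rayleigh A = v \<bullet> (A *v v)"
    unfolding min_rayleigh_def by (intro cInf_eq_minimum) auto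
  with v(1) show thesis
    by (intro that[of v]) auto
qed

lemma min_rayleigh_le:
  fixes A :: "real^'n^'n"
  assumes "norm v = 1"
  shows "min_rayleigh A \<le> v \<bullet> (A *v v)"
  unfolding min_rayleigh_def
proof (rule cINF_lower)
  have "- norm A \<le> w \<bullet> (A *v w)" if "norm w = 1" for w
    using abs_inner_matrix_vector_le[of w A] that by simp
  then show "bdd_below ((\<lambda>v. v \<bullet> (A *v v)) ` sphere 0 1)"
    by (intro bdd_belowI2[of _ "- norm A"]) auto
qed (use assms in simp)

lemma min_rayleigh_mult_norm_le:
  fixes A :: "real^'n^'n"
  shows "min_rayleigh A * (norm x)\<^sup>2 \<le> x \<bullet> (A *v x)"
proof (cases "x = 0")
  case False
  have "min_rayleigh A \<le> (x /\<^sub>R norm x) \<bullet> (A *v (x /\<^sub>R norm x))"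
    using False by (intro min_rayleigh_le) simp
  then have "min_rayleigh A * (norm x)\<^sup>2 \<le> (x /\<^sub>R norm x) \<bullet> (A *v (x /\<^sub>R norm x)) * (norm x)\<^sup>2"
    by (rule mult_right_mono) simp
  then show ?thesis
    using False by (simp add: matrix_vector_mult_scaleR power2_eq_square field_simps)
qed simp

lemma min_rayleigh_le_norm: "min_rayleigh A \<le> norm A"
proof -
  obtain v where "norm v = 1" "v \<bullet> (A *v v) = min_rayleigh A"
    by (rule min_rayleigh_attained)
  then show ?thesis
    using abs_inner_matrix_vector_le[of v A] by simp
qed

lemma min_rayleigh_diff_le:
  fixes A B :: "real^'n^'n"
  shows "min_rayleigh A - min_rayleigh B \<le> norm (A - B)"
proof -
  obtain v where v: "norm v = 1" "v \<bullet> (B *v v) = min_rayleigh B"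
    by (rule min_rayleigh_attained)
  have "v \<bullet> (A *v v) = min_rayleigh B + v \<bullet> ((A - B) *v v)"
    by (simp add: v(2)[symmetric] matrix_vector_mult_diff_rdistrib inner_diff_right)
  then show ?thesis
    using min_rayleigh_le[OF v(1), of A] abs_inner_matrix_vector_le[of v "A - B"] v(1) by simp
qed

lemma continuous_on_min_rayleigh: "continuous_on UNIV min_rayleigh"
proof (rule lipschitz_on_continuous_on[OF lipschitz_onI])
  show "dist (min_rayleigh A) (min_rayleigh B) \<le> 1 * dist A B" for A B :: "real^'n^'n"
    using min_rayleigh_diff_le[of A B] min_rayleigh_diff_le[of B A]
    by (simp add: dist_norm norm_minus_commute)
qed simp

lemma borel_measurable_min_rayleigh [measurable]: "min_rayleigh \<in> borel_measurable borel"
  by (intro borel_measurable_continuous_onI continuous_on_min_rayleigh)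

lemma min_rayleigh_pos_imp_invertible:
  fixes A :: "real^'n^'n"
  assumes A: "0 < min_rayleigh A"
  shows "invertible A" and "onorm ((*v) (matrix_inv A)) \<le> 1 / min_rayleigh A"
proof -
  have lower: "min_rayleigh A * norm x \<le> norm (A *v x)" for x
  proof (cases "x = 0")
    case False
    have "min_rayleigh A * norm x * norm x \<le> norm (A *v x) * norm x"
      using min_rayleigh_mult_norm_le[of A x] norm_cauchy_schwarz[of x "A *v x"]
      by (simp add: power2_eq_square mult_ac)
    then show ?thesis
      using False by simp
  qed simp
  have "x = 0" if "A *v x = 0" for x
    using lower[of x] that A by (simp add: mult_le_0_iff)
  then show invertible: "invertible A"
    unfolding invertible_left_inverse matrix_left_invertible_ker by blast
  show "onorm ((*v) (matrix_inv A)) \<le> 1 / min_rayleigh A"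
  proof (rule onorm_le)
    fix y
    have "A *v (matrix_inv A *v y) = y"
      by (simp add: matrix_vector_mul_assoc matrix_inv_right[OF invertible])
    then show "norm (matrix_inv A *v y) \<le> 1 / min_rayleigh A * norm y"
      using lower[of "matrix_inv A *v y"] A by (simp add: field_simps)
  qed
qed

lemma inverse_abs_det_le_min_rayleigh:
  fixes A :: "real^'n^'n"
  assumes A: "0 < min_rayleigh A"
  shows "1 / \<bar>det A\<bar> \<le> fact CARD('n) * (1 / min_rayleigh A) ^ CARD('n)"
proof -
  note inverse = min_rayleigh_pos_imp_invertible[OF A]
  have "det A * det (matrix_inv A) = 1"
    using arg_cong[OF matrix_inv_right[OF inverse(1)], of det] by (simp add: det_mul)
  then have "1 / \<bar>det A\<bar> = \<bar>det (matrix_inv A)\<bar>"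
    using inverse(1) by (simp add: invertible_det_nz field_simps abs_mult[symmetric])
  also have "\<dots> \<le> fact CARD('n) * onorm ((*v) (matrix_inv A)) ^ CARD('n)"
    by (rule abs_det_le_onorm)
  also have "\<dots> \<le> fact CARD('n) * (1 / min_rayleigh A) ^ CARD('n)"
    by (intro mult_left_mono power_mono inverse(2) onorm_pos_le) auto
  finally show ?thesis .
qed

lemma norm_matrix_inv_diff_le:
  fixes A S :: "real^'n^'n"
  assumes A: "0 < min_rayleigh A" and S: "0 < min_rayleigh S"
  shows "norm (matrix_inv A - matrix_inv S)
    \<le> (real CARD('n))\<^sup>2 / min_rayleigh S * norm (A - S) / min_rayleigh A"
proof -
  note inverse_A = min_rayleigh_pos_imp_invertible[OF A]
  note inverse_S = min_rayleigh_pos_imp_invertible[OF S]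
  have inv_le: "norm (matrix_inv B *v y) \<le> norm y / min_rayleigh B" if "0 < min_rayleigh B"
    for B :: "real^'n^'n" and y
    using onorm[OF matrix_vector_mul_bounded_linear, of "matrix_inv B" y]
      mult_right_mono[OF min_rayleigh_pos_imp_invertible(2)[OF that] norm_ge_zero[of y]] by simp
  have "onorm ((*v) (matrix_inv A - matrix_inv S)) \<le> norm (A - S) / min_rayleigh S / min_rayleigh A"
  proof (rule onorm_le)
    fix y
    have "matrix_inv A *v (S *v (matrix_inv S *v y)) = matrix_inv A *v y"
      by (simp add: matrix_vector_mul_assoc matrix_inv_right[OF inverse_S(1)])
    moreover have "matrix_inv A *v (A *v (matrix_inv S *v y)) = matrix_inv S *v y"
      by (simp add: matrix_vector_mul_assoc matrix_mul_assoc matrix_inv_left[OF inverse_A(1)])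
    ultimately have "(matrix_inv A - matrix_inv S) *v y
        = matrix_inv A *v ((S - A) *v (matrix_inv S *v y))"
      by (simp add: matrix_vector_mult_diff_rdistrib matrix_vector_mult_diff_distrib)
    also have "norm \<dots> \<le> norm ((S - A) *v (matrix_inv S *v y)) / min_rayleigh A"
      by (rule inv_le[OF A])
    also have "\<dots> \<le> norm (S - A) * (norm y / min_rayleigh S) / min_rayleigh A"
      using A
      by (intro divide_right_mono order_trans[OF norm_matrix_vector_mult_le]
          mult_left_mono inv_le[OF S]) auto
    finally show "norm ((matrix_inv A - matrix_inv S) *v y)
        \<le> norm (A - S) / min_rayleigh S / min_rayleigh A * norm y"
      by (simp add: norm_minus_commute)
  qed
  then have "(real CARD('n))\<^sup>2 * onorm ((*v) (matrix_inv A - matrix_inv S))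
      \<le> (real CARD('n))\<^sup>2 * (norm (A - S) / min_rayleigh S / min_rayleigh A)"
    by (rule mult_left_mono) simp
  then show ?thesis
    using norm_le_card_mult_onorm[of "matrix_inv A - matrix_inv S"] by simp
qed

lemma powr_le_add_power:
  fixes x q :: real
  assumes "0 \<le> x" "1 \<le> q" "q \<le> real k"
  shows "x powr q \<le> x + x ^ k"
proof (cases "x \<le> 1")
  case True
  then have "x powr q \<le> x powr 1"
    using assms by (intro powr_mono') auto
  also have "\<dots> \<le> x + x ^ k"
    using assms by simp
  finally show ?thesis .
next
  case False
  then have "x powr q \<le> x powr real k"
    using assms by (intro powr_mono) auto
  also have "\<dots> \<le> x + x ^ k"
    using False by (simp add: powr_realpow)
  finally show ?thesis .
qed

lemma ennreal_powr_le_add_power: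
  assumes x: "0 \<le> x" "ennreal x \<le> u" and q: "1 \<le> q" "q \<le> real k"
  shows "ennreal (x powr q) \<le> u + u ^ k"
proof -
  have "ennreal (x powr q) \<le> ennreal (x + x ^ k)"
    using powr_le_add_power[OF x(1) q] by (rule ennreal_leI)
  also have "\<dots> = ennreal x + ennreal x ^ k"
    using x(1) by (simp add: ennreal_power)
  also have "\<dots> \<le> u + u ^ k"
    using x(2) by (intro add_mono power_mono) auto
  finally show ?thesis .
qed

lemma inverse_det_powr_le:
  fixes A :: "real^'n^'n"
  assumes A: "0 \<le> min_rayleigh A" and q: "1 \<le> q" "q \<le> real k"
  defines "u \<equiv> ennreal (fact CARD('n)) * inverse (ennreal (min_rayleigh A)) ^ CARD('n)"
  shows "(let d = det A in if d = 0 then \<infinity> else ennreal (d powr (- q))) \<le> u + u ^ k"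
proof (cases "min_rayleigh A = 0")
  case True
  then have "u = \<infinity>"
    by (simp add: u_def ennreal_mult_top top_power_ennreal)
  then show ?thesis
    by simp
next
  case False
  then have pos: "0 < min_rayleigh A"
    using A by simp
  then have "det A \<noteq> 0"
    using min_rayleigh_pos_imp_invertible(1) invertible_det_nz by blast
  have "ennreal (1 / \<bar>det A\<bar>) \<le> ennreal (fact CARD('n) * (1 / min_rayleigh A) ^ CARD('n))"
    using inverse_abs_det_le_min_rayleigh[OF pos] by (rule ennreal_leI)
  also have "\<dots> = u"
    using pos by (simp add: u_def ennreal_mult' inverse_ennreal ennreal_power inverse_eq_divide)
  finally have "ennreal ((1 / \<bar>det A\<bar>) powr q) \<le> u + u ^ k"
    using q by (intro ennreal_powr_le_add_power) auto
  moreover have "det A powr (- q) = (1 / \<bar>det A\<bar>) powr q"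
    by (simp add: powr_def abs_if ln_minus ln_div)
  ultimately show ?thesis
    using \<open>det A \<noteq> 0\<close> by simp
qed

lemma matrix_inv_diff_powr_le:
  fixes A S :: "real^'n^'n"
  assumes A: "0 \<le> min_rayleigh A" and S: "0 < min_rayleigh S" and q: "1 \<le> q" "q \<le> real k"
  defines "u \<equiv> ennreal ((real CARD('n))\<^sup>2 / min_rayleigh S * norm (A - S))
      * inverse (ennreal (min_rayleigh A))"
  shows "ennreal (norm (matrix_inv A - matrix_inv S) powr q) \<le> u + u ^ k"
proof (rule ennreal_powr_le_add_power[OF _ _ q])
  show "ennreal (norm (matrix_inv A - matrix_inv S)) \<le> u"
  proof (cases "min_rayleigh A = 0")
    case True
    then have "A \<noteq> S"
      using S by auto
    then have "0 < (real CARD('n))\<^sup>2 / min_rayleigh S * norm (A - S)"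
      using S by simp
    then show ?thesis
      using True by (simp add: u_def ennreal_mult_top ennreal_eq_0_iff)
  next
    case False
    then have pos: "0 < min_rayleigh A"
      using A by simp
    have "ennreal (norm (matrix_inv A - matrix_inv S))
        \<le> ennreal ((real CARD('n))\<^sup>2 / min_rayleigh S * norm (A - S) / min_rayleigh A)"
      using norm_matrix_inv_diff_le[OF pos S] by (rule ennreal_leI)
    also have "\<dots> = u"
      using pos S unfolding u_def divide_inverse[of _ "min_rayleigh A"]
      by (subst ennreal_mult') (simp_all add: inverse_ennreal)
    finally show ?thesis .
  qed
qed simp

section \<open>Bounding the minimal Rayleigh quotient from below by an integral\<close>

lemma inverse_ennreal_antimono:
  fixes a b :: ennreal
  assumes "a \<le> b"
  shows "inverse b \<le> inverse a"
  using assms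
  by (auto simp: less_eq_ennreal.rep_eq inverse_ennreal.rep_eq intro!: ereal_inverse_antimono)

definition shell_inverse_integral :: "nat \<Rightarrow> real^'n^'n \<Rightarrow> ennreal" where
  "shell_inverse_integral m A =
     (\<integral>\<^sup>+x. inverse (ennreal (x \<bullet> (A *v x))) ^ m * indicator (cball 0 2 - ball 0 1) x \<partial>lborel)"

lemma quadratic_form_add_le:
  fixes A :: "real^'n^'n"
  assumes "0 \<le> min_rayleigh A"
  shows "(x + y) \<bullet> (A *v (x + y)) \<le> 2 * (x \<bullet> (A *v x)) + 2 * (y \<bullet> (A *v y))"
proof -
  have "0 \<le> (x - y) \<bullet> (A *v (x - y))"
    using min_rayleigh_mult_norm_le[of A "x - y"] assms
    by (meson mult_nonneg_nonneg order_trans zero_le_power2)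
  then show ?thesis
    by (simp add: matrix_vector_right_distrib matrix_vector_mult_diff_distrib inner_add_left
        inner_add_right inner_diff_left inner_diff_right)
qed

lemma quadratic_form_le_on_ball:
  fixes A :: "real^'n^'n"
  assumes A: "0 \<le> min_rayleigh A" "norm A \<le> \<Lambda>" and t: "0 < t" "t \<le> \<Lambda>"
    and v: "norm v = 1" "v \<bullet> (A *v v) \<le> t" and x: "x \<in> ball ((3 / 2) *\<^sub>R v) (t / (2 * \<Lambda>))"
  shows "x \<bullet> (A *v x) \<le> 5 * t" and "x \<in> cball 0 2 - ball 0 1"
proof -
  let ?c = "(3 / 2) *\<^sub>R v" and ?r = "t / (2 * \<Lambda>)"
  define y where "y = x - ?c"
  have x_eq: "x = ?c + y" and y: "norm y \<le> ?r"
    using x by (simp_all add: y_def dist_norm norm_minus_commute)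
  have "y \<bullet> (A *v y) \<le> \<Lambda> * ?r\<^sup>2"
    using abs_inner_matrix_vector_le[of y A] mult_mono[OF A(2) power_mono[OF y, of 2]] t by auto
  also have "\<dots> \<le> t / 4"
    using t by (simp add: power2_eq_square field_simps)
  finally have "y \<bullet> (A *v y) \<le> t / 4" .
  moreover have "?c \<bullet> (A *v ?c) \<le> 9 / 4 * t"
    using v(2) by (simp add: matrix_vector_mult_scaleR)
  ultimately show "x \<bullet> (A *v x) \<le> 5 * t"
    using quadratic_form_add_le[OF A(1), of ?c y] by (simp add: x_eq)
  have "?r \<le> 1 / 2"
    using t by (simp add: field_simps)
  then show "x \<in> cball 0 2 - ball 0 1"
    using norm_triangle_ineq[of ?c y] norm_triangle_ineq4[of x y] v(1) y by (simp add: x_eq)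
qed

lemma shell_inverse_integral_ge:
  fixes A :: "real^'n^'n"
  assumes A: "0 \<le> min_rayleigh A" "norm A \<le> \<Lambda>" and t: "min_rayleigh A \<le> t" "0 < t" "t \<le> \<Lambda>"
  shows "ennreal ((1 / (5 * t)) ^ m * (unit_ball_vol CARD('n) * (t / (2 * \<Lambda>)) ^ CARD('n)))
    \<le> shell_inverse_integral m A"
proof -
  obtain v where v: "norm v = 1" "v \<bullet> (A *v v) = min_rayleigh A"
    by (rule min_rayleigh_attained)
  let ?U = "ball ((3 / 2) *\<^sub>R v) (t / (2 * \<Lambda>))"
  have "(\<integral>\<^sup>+x. ennreal ((1 / (5 * t)) ^ m) * indicator ?U x \<partial>lborel) \<le> shell_inverse_integral m A"
    unfolding shell_inverse_integral_def
  proof (rule nn_integral_mono)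
    fix x
    show "ennreal ((1 / (5 * t)) ^ m) * indicator ?U x
      \<le> inverse (ennreal (x \<bullet> (A *v x))) ^ m * indicator (cball 0 2 - ball 0 1) x"
    proof (cases "x \<in> ?U")
      case True
      have x: "x \<bullet> (A *v x) \<le> 5 * t" "x \<in> cball 0 2 - ball 0 1"
        using quadratic_form_le_on_ball[OF A t(2,3) v(1) _ True] v(2) t(1) by simp_all
      have "ennreal ((1 / (5 * t)) ^ m) = inverse (ennreal (5 * t)) ^ m"
        using t(2) by (simp add: inverse_ennreal ennreal_power inverse_eq_divide)
      also have "\<dots> \<le> inverse (ennreal (x \<bullet> (A *v x))) ^ m"
        using x(1) by (intro power_mono inverse_ennreal_antimono ennreal_leI) auto
      finally show ?thesis
        using True x(2) by simp
    qed simp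
  qed
  also have "(\<integral>\<^sup>+x. ennreal ((1 / (5 * t)) ^ m) * indicator ?U x \<partial>lborel)
      = ennreal ((1 / (5 * t)) ^ m) * ennreal (unit_ball_vol CARD('n) * (t / (2 * \<Lambda>)) ^ CARD('n))"
    using t by (simp add: nn_integral_cmult_indicator emeasure_ball)
  finally show ?thesis
    using t(2) by (simp add: ennreal_mult')
qed

definition shell_constant :: "nat \<Rightarrow> nat \<Rightarrow> real" where
  "shell_constant p b = 2 ^ p * 5 ^ (p + 2 * b) / unit_ball_vol p"

lemma shell_constant_pos: "0 < shell_constant p b"
  by (simp add: shell_constant_def)

lemma shell_constant_identity:
  assumes "0 < t" "0 < \<Lambda>"
  shows "(1 / (5 * t)) ^ (p + 2 * b) * (unit_ball_vol p * (t / (2 * \<Lambda>)) ^ p)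
    = ((1 / t) ^ b)\<^sup>2 / (shell_constant p b * \<Lambda> ^ p)"
  using assms
  by (simp add: shell_constant_def power_divide power_mult_distrib
      power_add power_mult[symmetric] mult.commute)

lemma inverse_min_rayleigh_power_le:
  fixes A :: "real^'n^'n"
  assumes A: "0 \<le> min_rayleigh A" and b: "0 < b"
  shows "inverse (ennreal (min_rayleigh A)) ^ b
    \<le> ennreal ((1 + norm A) ^ CARD('n))
      + ennreal (shell_constant CARD('n) b) * shell_inverse_integral (CARD('n) + 2 * b) A"
proof (cases "shell_inverse_integral (CARD('n) + 2 * b) A")
  case (real J)
  define \<Lambda> where "\<Lambda> = 1 + norm A"
  let ?p = "CARD('n)" and ?r = "min_rayleigh A" and ?K = "shell_constant CARD('n) b"
  have \<Lambda>: "1 \<le> \<Lambda>" "norm A \<le> \<Lambda>" "?r \<le> \<Lambda>"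
    using min_rayleigh_le_norm[of A] by (simp_all add: \<Lambda>_def)
  have sum_nonneg: "0 \<le> \<Lambda> ^ ?p + ?K * J"
    using real shell_constant_pos[of ?p b] \<Lambda>(1) by simp
  have bound: "(1 / t) ^ b \<le> \<Lambda> ^ ?p + ?K * J" if t: "?r \<le> t" "0 < t" "t \<le> \<Lambda>" for t
  proof (rule power2_le_imp_le[OF _ sum_nonneg])
    have "((1 / t) ^ b)\<^sup>2 / (?K * \<Lambda> ^ ?p) \<le> J"
      using shell_inverse_integral_ge[OF A \<Lambda>(2) t, of "?p + 2 * b"] real \<Lambda>(1) t(2)
      by (simp add: shell_constant_identity)
    then have "((1 / t) ^ b)\<^sup>2 \<le> \<Lambda> ^ ?p * (?K * J)"
      using shell_constant_pos[of ?p b] \<Lambda>(1) by (simp add: pos_divide_le_eq mult_ac)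
    also have "\<dots> \<le> (\<Lambda> ^ ?p + ?K * J)\<^sup>2"
      using real shell_constant_pos[of ?p b] \<Lambda>(1) by (simp add: power2_sum)
    finally show "((1 / t) ^ b)\<^sup>2 \<le> (\<Lambda> ^ ?p + ?K * J)\<^sup>2" .
  qed
  have "?r \<noteq> 0"
  proof
    assume r: "?r = 0"
    let ?t = "1 / (1 + (\<Lambda> ^ ?p + ?K * J))"
    have "(1 / ?t) ^ b \<le> \<Lambda> ^ ?p + ?K * J"
      using r sum_nonneg \<Lambda>(1) by (intro bound order_trans[OF _ \<Lambda>(1)]) auto
    moreover have "1 / ?t \<le> (1 / ?t) ^ b"
      using b sum_nonneg by (intro self_le_power) auto
    ultimately show False
      by simp
  qed
  then have "0 < ?r"
    using A by simp
  then have "ennreal ((1 / ?r) ^ b) \<le> ennreal (\<Lambda> ^ ?p + ?K * J)"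
    using \<Lambda>(3) by (intro ennreal_leI bound) auto
  also have "\<dots> = ennreal (\<Lambda> ^ ?p) + ennreal ?K * ennreal J"
    using real(1) shell_constant_pos[of ?p b] \<Lambda>(1) by (simp add: ennreal_mult')
  finally show ?thesis
    using \<open>0 < ?r\<close> real(2) by (simp add: \<Lambda>_def inverse_ennreal ennreal_power inverse_eq_divide)
qed (use shell_constant_pos[of "CARD('n)" b] in \<open>simp add: ennreal_mult_top ennreal_eq_0_iff\<close>)

section \<open>Gram matrices\<close>

lemma gram_quadratic_form:
  fixes b :: "nat \<Rightarrow> 'p::finite \<Rightarrow> real"
  shows "x \<bullet> (gram_matrix n b *v x) = (\<Sum>i<n. (\<Sum>j\<in>UNIV. x $ j * b i j)\<^sup>2)"
proof -
  have "x \<bullet> (gram_matrix n b *v x) = (\<Sum>j\<in>UNIV. \<Sum>k\<in>UNIV. \<Sum>i<n. (x $ j * b i j) * (x $ k * b i k))"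
    by (simp add: inner_vec_def matrix_vector_mult_def gram_matrix_def sum_distrib_left
        sum_distrib_right mult_ac)
  also have "\<dots> = (\<Sum>j\<in>UNIV. \<Sum>i<n. \<Sum>k\<in>UNIV. (x $ j * b i j) * (x $ k * b i k))"
    by (intro sum.cong refl sum.swap)
  also have "\<dots> = (\<Sum>i<n. \<Sum>j\<in>UNIV. \<Sum>k\<in>UNIV. (x $ j * b i j) * (x $ k * b i k))"
    by (rule sum.swap)
  finally show ?thesis
    by (simp add: power2_eq_square sum_product)
qed

lemma trace_gram_matrix:
  fixes b :: "nat \<Rightarrow> 'p::finite \<Rightarrow> real"
  shows "trace (gram_matrix n b) = (\<Sum>i<n. \<Sum>j\<in>UNIV. (b i j)\<^sup>2)"
  unfolding trace_def gram_matrix_def by (simp add: power2_eq_square) (rule sum.swap)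

lemma min_rayleigh_gram_matrix_nonneg: "0 \<le> min_rayleigh (gram_matrix n b)"
proof -
  obtain v where v: "v \<bullet> (gram_matrix n b *v v) = min_rayleigh (gram_matrix n b)"
    by (rule min_rayleigh_attained)
  show ?thesis
    unfolding v[symmetric] gram_quadratic_form by (simp add: sum_nonneg)
qed

lemma norm_outer_product:
  fixes u :: "'p::finite \<Rightarrow> real"
  shows "norm (\<chi> j k. u j * u k :: real^'p^'p) = (\<Sum>j\<in>UNIV. (u j)\<^sup>2)"
proof -
  have "norm (\<chi> k. u j * u k :: real^'p) = \<bar>u j\<bar> * L2_set u UNIV" for j
    by (simp add: norm_vec_def L2_set_right_distrib abs_mult) (simp add: L2_set_def power_mult_distrib)
  then have "norm (\<chi> j k. u j * u k :: real^'p^'p) = L2_set (\<lambda>j. \<bar>u j\<bar> * L2_set u UNIV) UNIV"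
    by (simp add: norm_vec_def[of "\<chi> j k. u j * u k :: real^'p^'p"])
  also have "\<dots> = L2_set u UNIV * L2_set u UNIV"
    by (simp add: L2_set_left_distrib[symmetric]) (simp add: L2_set_def)
  also have "\<dots> = (\<Sum>j\<in>UNIV. (u j)\<^sup>2)"
    by (simp add: L2_set_def sum_nonneg)
  finally show ?thesis .
qed

lemma norm_gram_matrix_le_trace:
  fixes b :: "nat \<Rightarrow> 'p::finite \<Rightarrow> real"
  shows "norm (gram_matrix n b) \<le> trace (gram_matrix n b)"
proof -
  have "gram_matrix n b = (\<Sum>i<n. (\<chi> j k. b i j * b i k))"
    by (simp add: gram_matrix_def vec_eq_iff)
  then have "norm (gram_matrix n b) \<le> (\<Sum>i<n. norm (\<chi> j k. b i j * b i k :: real^'p^'p))"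
    by (simp add: norm_sum)
  then show ?thesis
    by (simp only: norm_outer_product trace_gram_matrix)
qed

lemma norm_gram_matrix_mult_le:
  fixes b :: "nat \<Rightarrow> 'p::finite \<Rightarrow> real"
  shows "(norm (gram_matrix n b *v x))\<^sup>2 \<le> trace (gram_matrix n b) * (x \<bullet> (gram_matrix n b *v x))"
proof -
  define y where "y i = (\<Sum>j\<in>UNIV. x $ j * b i j)" for i
  have component: "(gram_matrix n b *v x) $ j = (\<Sum>i<n. b i j * y i)" for j
  proof -
    have "(gram_matrix n b *v x) $ j = (\<Sum>k\<in>UNIV. \<Sum>i<n. b i j * (x $ k * b i k))"
      by (simp add: matrix_vector_mult_def gram_matrix_def sum_distrib_left
        sum_distrib_right mult_ac)
    also have "\<dots> = (\<Sum>i<n. b i j * y i)"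
      by (subst sum.swap) (simp add: y_def sum_distrib_left)
    finally show ?thesis .
  qed
  have "(norm (gram_matrix n b *v x))\<^sup>2 = (\<Sum>j\<in>UNIV. (\<Sum>i<n. b i j * y i)\<^sup>2)"
    unfolding power2_norm_eq_inner inner_vec_def component by (simp add: power2_eq_square)
  also have "\<dots> \<le> (\<Sum>j\<in>UNIV. (\<Sum>i<n. (b i j)\<^sup>2) * (\<Sum>i<n. (y i)\<^sup>2))"
    by (intro sum_mono Cauchy_Schwarz_ineq_sum)
  also have "\<dots> = trace (gram_matrix n b) * (x \<bullet> (gram_matrix n b *v x))"
    unfolding sum_distrib_right[symmetric] gram_quadratic_form y_def trace_def
    by (simp add: gram_matrix_def power2_eq_square)
  finally show ?thesis .
qed

lemma min_rayleigh_pos_of_gram_limit: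
  fixes S :: "real^'p^'p"
  assumes S: "invertible S" "S \<in> closure {gram_matrix n b |n b. True}"
  shows "0 < min_rayleigh S"
proof -
  obtain v where v: "norm v = 1" "v \<bullet> (S *v v) = min_rayleigh S"
    by (rule min_rayleigh_attained)
  let ?C = "{G :: real^'p^'p. 0 \<le> trace G \<and> (norm (G *v v))\<^sup>2 \<le> trace G * (v \<bullet> (G *v v))}"
  have "closed ?C"
    unfolding trace_def matrix_vector_mult_def
    by (intro closed_Collect_conj closed_Collect_le continuous_intros)
  moreover have "{gram_matrix n b |n b. True} \<subseteq> ?C"
    using norm_gram_matrix_mult_le norm_gram_matrix_le_trace
    by (force intro: order_trans[OF norm_ge_zero])
  ultimately have "S \<in> ?C"
    using closure_minimal S(2) by blast
  moreover have "S *v v \<noteq> 0"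
    using S(1) v(1) unfolding invertible_left_inverse matrix_left_invertible_ker by auto
  ultimately have "0 < trace S * min_rayleigh S" "0 \<le> trace S"
    using v(2) by (auto intro: less_le_trans[of _ "(norm (S *v v))\<^sup>2"])
  then show ?thesis
    by (simp add: zero_less_mult_iff)
qed

section \<open>Gram matrices with entries in the first chaos\<close>

lemma ennreal_tendsto_zero_of_power2:
  fixes f :: "nat \<Rightarrow> ennreal"
  assumes "(\<lambda>n. (f n)\<^sup>2) \<longlonglongrightarrow> 0"
  shows "f \<longlonglongrightarrow> 0"
proof (rule order_tendstoI)
  fix x :: ennreal assume "0 < x"
  then have "\<forall>\<^sub>F n in sequentially. (f n)\<^sup>2 < x\<^sup>2"
    using assms by (intro order_tendstoD) (auto simp: power2_eq_square ennreal_zero_less_mult_iff)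
  then show "\<forall>\<^sub>F n in sequentially. f n < x"
    by (rule eventually_mono) (meson not_less power_mono zero_le)
qed simp

lemma power_add_le_two_power:
  fixes x y :: real
  assumes "0 \<le> x" "0 \<le> y"
  shows "(x + y) ^ k \<le> 2 ^ k * (x ^ k + y ^ k)"
proof -
  have "(x + y) ^ k \<le> (2 * max x y) ^ k"
    using assms by (intro power_mono) auto
  also have "\<dots> = 2 ^ k * max x y ^ k"
    by (simp add: power_mult_distrib)
  also have "max x y ^ k \<le> x ^ k + y ^ k"
    using assms by (simp add: max_def)
  finally show ?thesis
    by simp
qed

lemma (in prob_space) variance_le_expectation_square_diff:
  assumes "square_integrable M X"
  shows "variance X \<le> expectation (\<lambda>\<omega>. (X \<omega> - a)\<^sup>2)"
proof -
  have X: "integrable M X" "integrable M (\<lambda>\<omega>. (X \<omega>)\<^sup>2)"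
    using assms
    by (simp_all add: integrable_of_square_integrable
        square_integrable_imp_integrable_square)
  have "expectation (\<lambda>\<omega>. (X \<omega> - a)\<^sup>2) = expectation (\<lambda>\<omega>. (X \<omega>)\<^sup>2) - 2 * a * expectation X + a\<^sup>2"
    using X by (simp add: power2_diff prob_space mult.commute mult.left_commute)
  then show ?thesis
    using variance_eq[OF X] zero_le_power2[of "expectation X - a"]
    by (simp add: power2_diff algebra_simps)
qed

locale convergent_gram = gaussian_sequence M N for M :: "'a measure" and N +
  fixes B :: "nat \<Rightarrow> nat \<Rightarrow> 'p::finite \<Rightarrow> 'a \<Rightarrow> real" and S :: "real^'p^'p"
  assumes entries: "\<And>n i j. i < n \<Longrightarrow> B n i j \<in> first_wiener_chaos M N"
    and limit_invertible: "invertible S"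
    and tendsto_limit: "tendsto_zero_in_prob (\<lambda>n \<omega>. norm (gram_matrix n (\<lambda>i j. B n i j \<omega>) - S))"
begin

definition gram :: "nat \<Rightarrow> 'a \<Rightarrow> real^'p^'p" where
  "gram n \<omega> = gram_matrix n (\<lambda>i j. B n i j \<omega>)"

definition deviation :: "nat \<Rightarrow> 'a \<Rightarrow> real" where
  "deviation n \<omega> = norm (gram n \<omega> - S)"

definition form_coordinate :: "nat \<Rightarrow> real^'p \<Rightarrow> nat \<Rightarrow> 'a \<Rightarrow> real" where
  "form_coordinate n x i \<omega> = (\<Sum>j\<in>UNIV. x $ j * B n i j \<omega>)"

lemma gram_measurable [measurable]: "gram n \<in> borel_measurable M"
proof -
  have component: "(\<lambda>\<omega>. gram n \<omega> $ j $ k) \<in> borel_measurable M" for j k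
    unfolding gram_def gram_matrix_def vec_lambda_beta
    by (intro borel_measurable_sum borel_measurable_times chaos_measurable entries) auto
  have "(\<lambda>\<omega>. gram n \<omega> \<bullet> b) \<in> borel_measurable M" if b: "b \<in> Basis" for b
  proof -
    obtain j k where "b = axis j (axis k 1)"
      using b by (auto simp: Basis_vec_def)
    then show ?thesis
      using component[of j k] by (simp add: inner_axis)
  qed
  then show ?thesis
    by (simp add: borel_measurable_euclidean_space[of "gram n"])
qed

lemma deviation_measurable [measurable]: "deviation n \<in> borel_measurable M"
  unfolding deviation_def[abs_def] by measurable

lemma deviation_nonneg: "0 \<le> deviation n \<omega>"
  by (simp add: deviation_def)

lemma min_rayleigh_gram_nonneg: "0 \<le> min_rayleigh (gram n \<omega>)"
  unfolding gram_def by (rule min_rayleigh_gram_matrix_nonneg)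

lemma deviation_tendsto_zero_in_prob: "tendsto_zero_in_prob deviation"
  using tendsto_limit by (simp add: deviation_def[abs_def] gram_def)

lemma trace_gram: "trace (gram n \<omega>) = sum_squares ({..<n} \<times> UNIV) (\<lambda>(i, j). B n i j) \<omega>"
  by (simp add: gram_def trace_gram_matrix sum_squares_def sum.cartesian_product case_prod_unfold)

lemma trace_gram_moment:
  shows "integrable M (\<lambda>\<omega>. trace (gram n \<omega>) ^ k)"
    and "expectation (\<lambda>\<omega>. trace (gram n \<omega>) ^ k)
      \<le> fact (2 * k) / (2 ^ k * fact k) * expectation (\<lambda>\<omega>. trace (gram n \<omega>)) ^ k"
  unfolding trace_gram by (intro chaos_sum_squares_moment; use entries in auto)+

lemma trace_gram_nonneg: "0 \<le> trace (gram n \<omega>)"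
  by (simp add: trace_gram sum_squares_nonneg)

lemma expectation_trace_gram_bounded:
  "\<forall>\<^sub>F n in sequentially. expectation (\<lambda>\<omega>. trace (gram n \<omega>)) \<le> 2 * real CARD('p) * (norm S + 1)"
proof -
  have "\<forall>\<^sub>F n in sequentially. prob {\<omega> \<in> space M. 1 < \<bar>deviation n \<omega>\<bar>} < 1 / 12"
    by (intro tendsto_zero_in_probD[OF deviation_tendsto_zero_in_prob]) auto
  then show ?thesis
  proof eventually_elim
    case (elim n)
    let ?R = "\<lambda>\<omega>. trace (gram n \<omega>)" and ?K = "2 * real CARD('p) * (norm S + 1)"
    have "1 < deviation n \<omega>" if R: "?K / 2 < ?R \<omega>" for \<omega>
    proof -
      have "?R \<omega> \<le> real CARD('p) * norm (gram n \<omega>)"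
        by (rule trace_le_card_mult_norm)
      also have "\<dots> \<le> real CARD('p) * (norm S + deviation n \<omega>)"
        unfolding deviation_def by (intro mult_left_mono norm_triangle_sub) simp
      finally have "real CARD('p) * (norm S + 1) < real CARD('p) * (norm S + deviation n \<omega>)"
        using R by linarith
      then show ?thesis
        by simp
    qed
    then have "prob {\<omega> \<in> space M. ?K / 2 < ?R \<omega>} \<le> prob {\<omega> \<in> space M. 1 < \<bar>deviation n \<omega>\<bar>}"
      by (intro finite_measure_mono) (auto intro: less_le_trans[OF _ abs_ge_self])
    then have tail: "3 * prob {\<omega> \<in> space M. ?K / 2 < ?R \<omega>} < 1 / 4"
      using elim by linarith
    have second_moment: "expectation (\<lambda>\<omega>. (?R \<omega>)\<^sup>2) \<le> 3 * (expectation ?R)\<^sup>2"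
      using trace_gram_moment(2)[of n 2] by (simp add: fact_numeral)
    have "square_integrable M ?R"
      using trace_gram_moment(1)[of n 1] trace_gram_moment(1)[of n 2]
      by (simp add: square_integrable_def)
    from expectation_le_of_small_tail[OF this trace_gram_nonneg second_moment tail] show ?case
      by simp
  qed
qed

lemma deviation_power_le:
  "deviation n \<omega> ^ k \<le> 2 ^ k * (trace (gram n \<omega>) ^ k + norm S ^ k)"
proof -
  have "deviation n \<omega> \<le> norm (gram n \<omega>) + norm S"
    unfolding deviation_def by (rule norm_triangle_ineq4)
  also have "\<dots> \<le> trace (gram n \<omega>) + norm S"
    unfolding gram_def by (intro add_right_mono norm_gram_matrix_le_trace)
  finally have "deviation n \<omega> ^ k \<le> (trace (gram n \<omega>) + norm S) ^ k"
    by (intro power_mono deviation_nonneg)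
  also have "\<dots> \<le> 2 ^ k * (trace (gram n \<omega>) ^ k + norm S ^ k)"
    by (intro power_add_le_two_power trace_gram_nonneg norm_ge_zero)
  finally show ?thesis .
qed

lemma integrable_deviation_power: "integrable M (\<lambda>\<omega>. deviation n \<omega> ^ k)"
proof (rule Bochner_Integration.integrable_bound)
  show "integrable M (\<lambda>\<omega>. 2 ^ k * (trace (gram n \<omega>) ^ k + norm S ^ k))"
    by (intro integrable_mult_right Bochner_Integration.integrable_add integrable_const trace_gram_moment)
  show "AE \<omega> in M. norm (deviation n \<omega> ^ k) \<le> norm (2 ^ k * (trace (gram n \<omega>) ^ k + norm S ^ k))"
    using deviation_power_le by (intro AE_I2) (simp add: deviation_nonneg trace_gram_nonneg)
qed measurable

lemma expectation_deviation_power_bounded: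
  obtains K where "\<forall>\<^sub>F n in sequentially. expectation (\<lambda>\<omega>. deviation n \<omega> ^ k) \<le> K"
proof -
  define C :: real where "C = fact (2 * k) / (2 ^ k * fact k)"
  let ?K = "2 * real CARD('p) * (norm S + 1)"
  have "\<forall>\<^sub>F n in sequentially. expectation (\<lambda>\<omega>. deviation n \<omega> ^ k) \<le> 2 ^ k * (C * ?K ^ k + norm S ^ k)"
    using expectation_trace_gram_bounded
  proof eventually_elim
    case (elim n)
    have "expectation (\<lambda>\<omega>. deviation n \<omega> ^ k)
        \<le> expectation (\<lambda>\<omega>. 2 ^ k * (trace (gram n \<omega>) ^ k + norm S ^ k))"
      by (intro integral_mono integrable_deviation_power deviation_power_le integrable_mult_right
          Bochner_Integration.integrable_add integrable_const trace_gram_moment)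
    also have "\<dots> = 2 ^ k * (expectation (\<lambda>\<omega>. trace (gram n \<omega>) ^ k) + norm S ^ k)"
      using trace_gram_moment(1)[of n k] by (simp add: prob_space)
    also have "expectation (\<lambda>\<omega>. trace (gram n \<omega>) ^ k) \<le> C * expectation (\<lambda>\<omega>. trace (gram n \<omega>)) ^ k"
      unfolding C_def by (rule trace_gram_moment)
    also have "\<dots> \<le> C * ?K ^ k"
      using elim trace_gram_nonneg by (intro mult_left_mono power_mono) (auto simp: C_def)
    finally show ?case
      by simp
  qed
  then show thesis
    by (rule that)
qed

lemma deviation_moment_tendsto_zero:
  assumes k: "0 < k"
  shows "(\<lambda>n. expectation (\<lambda>\<omega>. deviation n \<omega> ^ k)) \<longlonglongrightarrow> 0"
proof -
  obtain K where "\<forall>\<^sub>F n in sequentially. expectation (\<lambda>\<omega>. deviation n \<omega> ^ (k * 2)) \<le> K"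
    by (rule expectation_deviation_power_bounded)
  moreover have "square_integrable M (\<lambda>\<omega>. deviation n \<omega> ^ k)" for n
    unfolding square_integrable_def power_mult[symmetric] by (simp add: integrable_deviation_power)
  ultimately have "(\<lambda>n. expectation (\<lambda>\<omega>. \<bar>deviation n \<omega> ^ k\<bar>)) \<longlonglongrightarrow> 0"
    using tendsto_zero_in_prob_power[OF deviation_tendsto_zero_in_prob k]
    by (intro expectation_tendsto_zero_of_in_prob) (auto simp: power_mult)
  then show ?thesis
    by (simp add: deviation_nonneg)
qed

lemma min_rayleigh_limit_pos: "0 < min_rayleigh S"
proof (rule min_rayleigh_pos_of_gram_limit[OF limit_invertible])
  show "S \<in> closure {gram_matrix n b |n b. True}"
    unfolding closure_approachable
  proof (intro allI impI)
    fix e :: real assume "0 < e"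
    then have "\<forall>\<^sub>F n in sequentially. prob {\<omega> \<in> space M. e / 2 < \<bar>deviation n \<omega>\<bar>} < 1"
      by (intro tendsto_zero_in_probD[OF deviation_tendsto_zero_in_prob]) auto
    then obtain n where "prob {\<omega> \<in> space M. e / 2 < \<bar>deviation n \<omega>\<bar>} < 1"
      by (auto simp: eventually_sequentially)
    then have "{\<omega> \<in> space M. e / 2 < \<bar>deviation n \<omega>\<bar>} \<noteq> space M"
      using prob_space by auto
    then obtain \<omega> where "\<not> e / 2 < \<bar>deviation n \<omega>\<bar>"
      by blast
    then have "dist (gram n \<omega>) S < e"
      using \<open>0 < e\<close> by (simp add: deviation_def dist_norm)
    then show "\<exists>G\<in>{gram_matrix n b |n b. True}. dist G S < e"
      unfolding gram_def by blast
  qed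
qed

section \<open>Negative moments of the minimal Rayleigh quotient\<close>

lemma form_coordinate_chaos: "i < n \<Longrightarrow> form_coordinate n x i \<in> first_wiener_chaos M N"
  unfolding form_coordinate_def[abs_def] by (intro chaos_sum entries)

lemma gram_form: "x \<bullet> (gram n \<omega> *v x) = sum_squares {..<n} (form_coordinate n x) \<omega>"
  by (simp add: gram_def gram_quadratic_form sum_squares_def form_coordinate_def)

lemma abs_gram_form_diff_le:
  "\<bar>x \<bullet> (gram n \<omega> *v x) - x \<bullet> (S *v x)\<bar> \<le> deviation n \<omega> * (norm x)\<^sup>2"
  using abs_inner_matrix_vector_le[of x "gram n \<omega> - S"]
  by (simp add: deviation_def matrix_vector_mult_diff_rdistrib inner_diff_right)

lemma gram_form_mean_ge:
  "(min_rayleigh S - expectation (deviation n)) * (norm x)\<^sup>2 \<le> expectation (\<lambda>\<omega>. x \<bullet> (gram n \<omega> *v x))"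
proof -
  have integrable: "integrable M (deviation n)"
    using integrable_deviation_power[of n 1] by simp
  have "(min_rayleigh S - expectation (deviation n)) * (norm x)\<^sup>2
      \<le> expectation (\<lambda>\<omega>. x \<bullet> (S *v x) - deviation n \<omega> * (norm x)\<^sup>2)"
    using integrable min_rayleigh_mult_norm_le[of S x] by (simp add: prob_space left_diff_distrib)
  also have "\<dots> \<le> expectation (\<lambda>\<omega>. x \<bullet> (gram n \<omega> *v x))"
  proof (intro integral_mono)
    show "integrable M (\<lambda>\<omega>. x \<bullet> (gram n \<omega> *v x))"
      unfolding gram_form
      by (intro integrable_sum_squares chaos_square_integrable form_coordinate_chaos) simp
    show "x \<bullet> (S *v x) - deviation n \<omega> * (norm x)\<^sup>2 \<le> x \<bullet> (gram n \<omega> *v x)" for \<omega>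
      using abs_gram_form_diff_le[of x n \<omega>] by linarith
  qed (use integrable in simp)
  finally show ?thesis .
qed

lemma hs_covariance_form_le:
  "2 * (hs_covariance {..<n} (form_coordinate n x))\<^sup>2
     \<le> expectation (\<lambda>\<omega>. (deviation n \<omega>)\<^sup>2) * (norm x) ^ 4"
proof -
  let ?Q = "\<lambda>\<omega>. x \<bullet> (gram n \<omega> *v x)"
  have Q: "square_integrable M ?Q" "variance ?Q = 2 * (hs_covariance {..<n} (form_coordinate n x))\<^sup>2"
    unfolding gram_form
    using chaos_sum_squares_variance[of "{..<n}" "form_coordinate n x"] form_coordinate_chaos by auto
  have "variance ?Q \<le> expectation (\<lambda>\<omega>. (?Q \<omega> - x \<bullet> (S *v x))\<^sup>2)"
    using Q(1) by (rule variance_le_expectation_square_diff)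
  also have "\<dots> \<le> expectation (\<lambda>\<omega>. (deviation n \<omega>)\<^sup>2 * (norm x) ^ 4)"
  proof (intro integral_mono)
    show "integrable M (\<lambda>\<omega>. (?Q \<omega> - x \<bullet> (S *v x))\<^sup>2)"
      by (intro square_integrable_imp_integrable_square square_integrable_diff
          Q(1) square_integrable_const)
    have "\<bar>?Q \<omega> - x \<bullet> (S *v x)\<bar>\<^sup>2 \<le> (deviation n \<omega> * (norm x)\<^sup>2)\<^sup>2" for \<omega>
      by (intro power_mono abs_gram_form_diff_le) simp
    then show "(?Q \<omega> - x \<bullet> (S *v x))\<^sup>2 \<le> (deviation n \<omega>)\<^sup>2 * (norm x) ^ 4" for \<omega>
      by (simp add: power_mult_distrib power_mult[symmetric])
  qed (simp add: integrable_deviation_power)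
  finally show ?thesis
    unfolding Q(2) by simp
qed

lemma gram_form_negative_moment_le:
  assumes c: "0 < min_rayleigh S" and mean: "expectation (deviation n) \<le> min_rayleigh S / 2"
    and second_moment: "expectation (\<lambda>\<omega>. (deviation n \<omega>)\<^sup>2) \<le> 2 * h\<^sup>2"
    and h: "0 \<le> h" "4 * real m * h \<le> min_rayleigh S / 2" and x: "1 \<le> norm x"
  shows "(\<integral>\<^sup>+\<omega>. inverse (ennreal (x \<bullet> (gram n \<omega> *v x))) ^ m \<partial>M) \<le> ennreal ((4 / min_rayleigh S) ^ m)"
proof -
  let ?c = "min_rayleigh S" and ?Y = "form_coordinate n x"
  let ?mean_ge = "expectation (sum_squares {..<n} ?Y)"
  have "?c / 2 * (norm x)\<^sup>2 \<le> (?c - expectation (deviation n)) * (norm x)\<^sup>2"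
    using mean by (intro mult_right_mono) auto
  also have "\<dots> \<le> ?mean_ge"
    using gram_form_mean_ge[of n x] by (simp add: gram_form)
  finally have E_ge: "?c / 2 * (norm x)\<^sup>2 \<le> ?mean_ge" .
  moreover have "?c / 2 * 1 \<le> ?c / 2 * (norm x)\<^sup>2"
    using c one_le_power[OF x, of 2] by (intro mult_left_mono) auto
  ultimately have mean_ge: "?c / 2 \<le> ?mean_ge"
    by simp
  have "2 * (hs_covariance {..<n} ?Y)\<^sup>2 \<le> 2 * h\<^sup>2 * (norm x) ^ 4"
    by (rule order_trans[OF hs_covariance_form_le mult_right_mono[OF second_moment]]) simp
  then have "(hs_covariance {..<n} ?Y)\<^sup>2 \<le> (h * (norm x)\<^sup>2)\<^sup>2"
    by (simp add: power_mult_distrib power_mult[symmetric])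
  then have "hs_covariance {..<n} ?Y \<le> h * (norm x)\<^sup>2"
    by (rule power2_le_imp_le) (use h in simp)
  then have "4 * real m * hs_covariance {..<n} ?Y \<le> (4 * real m * h) * (norm x)\<^sup>2"
    by (simp add: mult.assoc mult_left_mono)
  also have "\<dots> \<le> ?c / 2 * (norm x)\<^sup>2"
    using h(2) by (rule mult_right_mono) simp
  also note E_ge
  finally have "(\<integral>\<^sup>+\<omega>. inverse (ennreal (x \<bullet> (gram n \<omega> *v x))) ^ m \<partial>M) \<le> ennreal ((2 / ?mean_ge) ^ m)"
    unfolding gram_form using mean_ge c form_coordinate_chaos by (intro chaos_negative_moment) auto
  also have "\<dots> \<le> ennreal ((4 / ?c) ^ m)"
    using mean_ge c by (intro ennreal_leI power_mono) (auto simp: field_simps)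
  finally show ?thesis .
qed

lemma gram_form_negative_moment_bounded:
  "\<forall>\<^sub>F n in sequentially. \<forall>x. 1 \<le> norm x \<longrightarrow>
     (\<integral>\<^sup>+\<omega>. inverse (ennreal (x \<bullet> (gram n \<omega> *v x))) ^ m \<partial>M) \<le> ennreal ((4 / min_rayleigh S) ^ m)"
proof -
  define h where "h = min_rayleigh S / (8 * real (Suc m))"
  note c = min_rayleigh_limit_pos
  then have h: "0 < h" "4 * real m * h \<le> min_rayleigh S / 2"
    by (simp_all add: h_def field_simps)
  have "\<forall>\<^sub>F n in sequentially. expectation (\<lambda>\<omega>. deviation n \<omega> ^ 1) < min_rayleigh S / 2"
    using c by (intro order_tendstoD(2)[OF deviation_moment_tendsto_zero]) auto
  moreover have "\<forall>\<^sub>F n in sequentially. expectation (\<lambda>\<omega>. (deviation n \<omega>)\<^sup>2) < 2 * h\<^sup>2"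
    using h(1) by (intro order_tendstoD(2)[OF deviation_moment_tendsto_zero]) auto
  ultimately show ?thesis
  proof eventually_elim
    case (elim n)
    then show ?case
      using c h by (intro allI impI gram_form_negative_moment_le[where h = h]) auto
  qed
qed

lemma shell_integrand_measurable:
  "(\<lambda>(x, \<omega>). inverse (ennreal (x \<bullet> (gram n \<omega> *v x))) ^ m * indicator (cball 0 2 - ball 0 1) x)
     \<in> borel_measurable (lborel \<Otimes>\<^sub>M M)"
proof -
  have [measurable]: "B n i j \<in> borel_measurable M" if "i \<in> {..<n}" for i j
    using that by (intro chaos_measurable entries) simp
  have [measurable]: "(\<lambda>x::real^'p. x $ j) \<in> borel_measurable borel" for j
    by (intro borel_measurable_continuous_onI continuous_intros)
  have "(\<lambda>z. inverse (ennreal (fst z \<bullet> (gram n (snd z) *v fst z))) ^ m)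
      \<in> borel_measurable (lborel \<Otimes>\<^sub>M M)"
    unfolding gram_def gram_quadratic_form by measurable
  moreover have "(\<lambda>z. indicator (cball 0 2 - ball 0 1) (fst z) :: ennreal)
      \<in> borel_measurable (lborel \<Otimes>\<^sub>M M)"
    by (rule measurable_compose[OF measurable_fst]) (auto intro: borel_measurable_indicator)
  ultimately show ?thesis
    unfolding case_prod_unfold by (rule borel_measurable_times_ennreal)
qed

lemma shell_inverse_integral_gram_measurable [measurable]:
  "(\<lambda>\<omega>. shell_inverse_integral m (gram n \<omega>)) \<in> borel_measurable M"
  using measurable_pair_swap[OF shell_integrand_measurable[of n m]]
  unfolding shell_inverse_integral_def case_prod_unfold
  by (intro lborel.borel_measurable_nn_integral) (simp add: case_prod_unfold)

lemma expectation_shell_inverse_integral_bounded: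
  "\<forall>\<^sub>F n in sequentially. (\<integral>\<^sup>+\<omega>. shell_inverse_integral m (gram n \<omega>) \<partial>M)
     \<le> ennreal ((4 / min_rayleigh S) ^ m * (unit_ball_vol CARD('p) * 2 ^ CARD('p)))"
  using gram_form_negative_moment_bounded[of m]
proof eventually_elim
  case (elim n)
  interpret P: pair_sigma_finite "lborel :: (real^'p) measure" M
    by (simp add: pair_sigma_finite_def sigma_finite_lborel sigma_finite_measure_axioms)
  let ?shell = "cball 0 2 - ball 0 1 :: (real^'p) set"
  let ?f = "\<lambda>x \<omega>. inverse (ennreal (x \<bullet> (gram n \<omega> *v x))) ^ m"
  have "(\<integral>\<^sup>+\<omega>. shell_inverse_integral m (gram n \<omega>) \<partial>M)
      = (\<integral>\<^sup>+x. (\<integral>\<^sup>+\<omega>. ?f x \<omega> * indicator ?shell x \<partial>M) \<partial>lborel)"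
    unfolding shell_inverse_integral_def by (rule P.Fubini'[OF shell_integrand_measurable])
  also have "\<dots> \<le> (\<integral>\<^sup>+x. ennreal ((4 / min_rayleigh S) ^ m) * indicator (cball (0::real^'p) 2) x \<partial>lborel)"
  proof (rule nn_integral_mono)
    fix x :: "real^'p"
    show "(\<integral>\<^sup>+\<omega>. ?f x \<omega> * indicator ?shell x \<partial>M)
        \<le> ennreal ((4 / min_rayleigh S) ^ m) * indicator (cball 0 2) x"
      using elim by (cases "x \<in> ?shell") auto
  qed
  also have "\<dots> = ennreal ((4 / min_rayleigh S) ^ m * (unit_ball_vol CARD('p) * 2 ^ CARD('p)))"
    using min_rayleigh_limit_pos by (simp add: nn_integral_cmult_indicator emeasure_cball ennreal_mult')
  finally show ?case .
qed

lemma norm_gram_moment_bounded: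
  "\<forall>\<^sub>F n in sequentially. (\<integral>\<^sup>+\<omega>. ennreal ((1 + norm (gram n \<omega>)) ^ CARD('p)) \<partial>M)
     \<le> ennreal (2 ^ CARD('p) * ((1 + norm S) ^ CARD('p) + 1))"
proof -
  let ?p = "CARD('p)"
  have "\<forall>\<^sub>F n in sequentially. expectation (\<lambda>\<omega>. deviation n \<omega> ^ ?p) < 1"
    by (intro order_tendstoD(2)[OF deviation_moment_tendsto_zero]) auto
  then show ?thesis
  proof eventually_elim
    case (elim n)
    have "(1 + norm (gram n \<omega>)) ^ ?p \<le> 2 ^ ?p * ((1 + norm S) ^ ?p + deviation n \<omega> ^ ?p)" for \<omega>
    proof -
      have "(1 + norm (gram n \<omega>)) ^ ?p \<le> ((1 + norm S) + deviation n \<omega>) ^ ?p"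
        unfolding deviation_def using norm_triangle_sub[of "gram n \<omega>" S] by (intro power_mono) auto
      also have "\<dots> \<le> 2 ^ ?p * ((1 + norm S) ^ ?p + deviation n \<omega> ^ ?p)"
        by (intro power_add_le_two_power deviation_nonneg) simp
      finally show ?thesis .
    qed
    then have "(\<integral>\<^sup>+\<omega>. ennreal ((1 + norm (gram n \<omega>)) ^ ?p) \<partial>M)
        \<le> (\<integral>\<^sup>+\<omega>. ennreal (2 ^ ?p * ((1 + norm S) ^ ?p + deviation n \<omega> ^ ?p)) \<partial>M)"
      by (intro nn_integral_mono ennreal_leI)
    also have "\<dots> = ennreal (expectation (\<lambda>\<omega>. 2 ^ ?p * ((1 + norm S) ^ ?p + deviation n \<omega> ^ ?p)))"
      by (intro nn_integral_eq_integral integrable_mult_right Bochner_Integration.integrable_add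
          integrable_const integrable_deviation_power AE_I2) (simp add: deviation_nonneg)
    also have "\<dots> \<le> ennreal (2 ^ ?p * ((1 + norm S) ^ ?p + 1))"
      using elim integrable_deviation_power by (intro ennreal_leI) (simp add: prob_space)
    finally show ?case .
  qed
qed


lemma inverse_min_rayleigh_moment_bounded:
  assumes b: "0 < b"
  obtains C where "0 < C"
    "\<forall>\<^sub>F n in sequentially. (\<integral>\<^sup>+\<omega>. inverse (ennreal (min_rayleigh (gram n \<omega>))) ^ b \<partial>M) \<le> ennreal C"
proof -
  let ?p = "CARD('p)"
  define m where "m = ?p + 2 * b"
  define C1 where "C1 = 2 ^ ?p * ((1 + norm S) ^ ?p + 1)"
  define C2 where "C2 = (4 / min_rayleigh S) ^ m * (unit_ball_vol ?p * 2 ^ ?p)"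
  let ?K = "shell_constant ?p b"

  have C: "0 < C1" "0 < C2" "0 < ?K"
    using min_rayleigh_limit_pos by (simp_all add: C1_def C2_def shell_constant_pos add_nonneg_pos)
  have "\<forall>\<^sub>F n in sequentially. (\<integral>\<^sup>+\<omega>. inverse (ennreal (min_rayleigh (gram n \<omega>))) ^ b \<partial>M)
      \<le> ennreal (C1 + ?K * C2)"
    using norm_gram_moment_bounded expectation_shell_inverse_integral_bounded[of m]
  proof eventually_elim
    case (elim n)
    have "(\<integral>\<^sup>+\<omega>. inverse (ennreal (min_rayleigh (gram n \<omega>))) ^ b \<partial>M)
        \<le> (\<integral>\<^sup>+\<omega>. ennreal ((1 + norm (gram n \<omega>)) ^ ?p)
            + ennreal ?K * shell_inverse_integral m (gram n \<omega>) \<partial>M)"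
      unfolding m_def
      by (intro nn_integral_mono inverse_min_rayleigh_power_le min_rayleigh_gram_nonneg b)
    also have "\<dots> = (\<integral>\<^sup>+\<omega>. ennreal ((1 + norm (gram n \<omega>)) ^ ?p) \<partial>M)
        + ennreal ?K * (\<integral>\<^sup>+\<omega>. shell_inverse_integral m (gram n \<omega>) \<partial>M)"
      by (simp add: nn_integral_add nn_integral_cmult)
    also have "\<dots> \<le> ennreal C1 + ennreal ?K * ennreal C2"
      using elim unfolding C1_def C2_def by (intro add_mono mult_left_mono) auto
    also have "\<dots> = ennreal (C1 + ?K * C2)"
      using C by (simp add: ennreal_mult')
    finally show ?case .
  qed
  moreover have "0 < C1 + ?K * C2"
    using C by (simp add: add_pos_pos)
  ultimately show thesis
    using that by blast
qed

section \<open>Moments of the inverse Gram matrices\<close>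

abbreviation inverse_min_rayleigh :: "nat \<Rightarrow> 'a \<Rightarrow> ennreal" where
  "inverse_min_rayleigh n \<omega> \<equiv> inverse (ennreal (min_rayleigh (gram n \<omega>)))"

theorem inverse_det_moment_bounded:
  assumes q: "1 \<le> q"
  obtains C where "0 < C"
    "\<forall>\<^sub>F n in sequentially.
      (\<integral>\<^sup>+\<omega>. (let d = det (gram n \<omega>) in if d = 0 then \<infinity> else ennreal (d powr (- q))) \<partial>M) \<le> ennreal C"
proof -
  let ?p = "CARD('p)" and ?F = "fact CARD('p) :: real"
  define k where "k = nat \<lceil>q\<rceil>"
  have k: "0 < k" "q \<le> real k"
    unfolding k_def using q by linarith+
  obtain C1 where C1: "0 < C1"
    and bound1: "\<forall>\<^sub>F n in sequentially. (\<integral>\<^sup>+\<omega>. inverse_min_rayleigh n \<omega> ^ ?p \<partial>M) \<le> ennreal C1"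
    by (rule inverse_min_rayleigh_moment_bounded[of ?p]) auto
  obtain C2 where C2: "0 < C2"
    and bound2: "\<forall>\<^sub>F n in sequentially. (\<integral>\<^sup>+\<omega>. inverse_min_rayleigh n \<omega> ^ (?p * k) \<partial>M) \<le> ennreal C2"
    using k by (auto intro: inverse_min_rayleigh_moment_bounded[of "?p * k"])
  have "\<forall>\<^sub>F n in sequentially.
      (\<integral>\<^sup>+\<omega>. (let d = det (gram n \<omega>) in if d = 0 then \<infinity> else ennreal (d powr (- q))) \<partial>M)
      \<le> ennreal (?F * C1 + ?F ^ k * C2)"
    using bound1 bound2
  proof eventually_elim
    case (elim n)
    let ?u = "\<lambda>\<omega>. ennreal ?F * inverse_min_rayleigh n \<omega> ^ ?p"
    have "(\<integral>\<^sup>+\<omega>. (let d = det (gram n \<omega>) in if d = 0 then \<infinity> else ennreal (d powr (- q))) \<partial>M)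
        \<le> (\<integral>\<^sup>+\<omega>. ?u \<omega> + ?u \<omega> ^ k \<partial>M)"
      by (intro nn_integral_mono inverse_det_powr_le min_rayleigh_gram_nonneg q k)
    also have "\<dots> = ennreal ?F * (\<integral>\<^sup>+\<omega>. inverse_min_rayleigh n \<omega> ^ ?p \<partial>M)
        + ennreal (?F ^ k) * (\<integral>\<^sup>+\<omega>. inverse_min_rayleigh n \<omega> ^ (?p * k) \<partial>M)"
      by (simp add: nn_integral_add nn_integral_cmult power_mult_distrib ennreal_power power_mult)
    also have "\<dots> \<le> ennreal ?F * ennreal C1 + ennreal (?F ^ k) * ennreal C2"
      using elim by (intro add_mono mult_left_mono) auto
    also have "\<dots> = ennreal (?F * C1 + ?F ^ k * C2)"
      using C1 C2 by (simp add: ennreal_mult')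
    finally show ?case .
  qed
  moreover have "0 < ?F * C1 + ?F ^ k * C2"
    using C1 C2 by (simp add: add_pos_pos)
  ultimately show thesis
    using that by blast
qed

lemma deviation_inverse_min_rayleigh_tendsto_zero:
  assumes k: "0 < k" and D: "0 \<le> D"
  shows "(\<lambda>n. \<integral>\<^sup>+\<omega>. (ennreal (D * deviation n \<omega>) * inverse_min_rayleigh n \<omega>) ^ k \<partial>M) \<longlonglongrightarrow> 0"
proof (rule ennreal_tendsto_zero_of_power2)
  obtain C where C: "0 < C"
    and bound: "\<forall>\<^sub>F n in sequentially. (\<integral>\<^sup>+\<omega>. inverse_min_rayleigh n \<omega> ^ (k * 2) \<partial>M) \<le> ennreal C"
    using k by (auto intro: inverse_min_rayleigh_moment_bounded[of "k * 2"])
  have upper: "\<forall>\<^sub>F n in sequentially.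
      (\<integral>\<^sup>+\<omega>. (ennreal (D * deviation n \<omega>) * inverse_min_rayleigh n \<omega>) ^ k \<partial>M)\<^sup>2
      \<le> ennreal (D ^ (k * 2) * expectation (\<lambda>\<omega>. deviation n \<omega> ^ (k * 2)) * C)"
    using bound
  proof eventually_elim
    case (elim n)
    let ?E = "expectation (\<lambda>\<omega>. deviation n \<omega> ^ (k * 2))"
    have "(\<integral>\<^sup>+\<omega>. ennreal (D * deviation n \<omega>) ^ (k * 2) \<partial>M)
        = (\<integral>\<^sup>+\<omega>. ennreal (D ^ (k * 2) * deviation n \<omega> ^ (k * 2)) \<partial>M)"
      using D by (simp add: ennreal_power deviation_nonneg power_mult_distrib)
    also have "\<dots> = ennreal (D ^ (k * 2) * ?E)"
      using D
      by (subst nn_integral_eq_integral) (auto simp: integrable_deviation_power deviation_nonneg)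
    finally have deviation_moment: "(\<integral>\<^sup>+\<omega>. ennreal (D * deviation n \<omega>) ^ (k * 2) \<partial>M)
        = ennreal (D ^ (k * 2) * ?E)" .
    have "(\<integral>\<^sup>+\<omega>. (ennreal (D * deviation n \<omega>) * inverse_min_rayleigh n \<omega>) ^ k \<partial>M)\<^sup>2
        \<le> (\<integral>\<^sup>+\<omega>. (ennreal (D * deviation n \<omega>) ^ k)\<^sup>2 \<partial>M)
            * (\<integral>\<^sup>+\<omega>. (inverse_min_rayleigh n \<omega> ^ k)\<^sup>2 \<partial>M)"
      unfolding power_mult_distrib by (rule Cauchy_Schwarz_nn_integral) measurable
    also have "\<dots> \<le> ennreal (D ^ (k * 2) * ?E) * ennreal C"
      using elim unfolding power_mult[symmetric] deviation_moment by (intro mult_left_mono) auto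
    also have "\<dots> = ennreal (D ^ (k * 2) * ?E * C)"
      using C by (intro ennreal_mult''[symmetric]) simp
    finally show ?case .
  qed
  have "(\<lambda>n. D ^ (k * 2) * expectation (\<lambda>\<omega>. deviation n \<omega> ^ (k * 2)) * C) \<longlonglongrightarrow> D ^ (k * 2) * 0 * C"
    using k by (intro tendsto_intros deviation_moment_tendsto_zero) simp
  then have limit: "(\<lambda>n. ennreal (D ^ (k * 2) * expectation (\<lambda>\<omega>. deviation n \<omega> ^ (k * 2)) * C)) \<longlonglongrightarrow> 0"
    using tendsto_ennrealI by fastforce
  show "(\<lambda>n. (\<integral>\<^sup>+\<omega>. (ennreal (D * deviation n \<omega>) * inverse_min_rayleigh n \<omega>) ^ k \<partial>M)\<^sup>2) \<longlonglongrightarrow> 0"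
    by (rule tendsto_sandwich[OF _ upper tendsto_const limit]) simp
qed

theorem matrix_inv_tendsto_Lq:
  assumes q: "1 \<le> q"
  shows "(\<lambda>n. \<integral>\<^sup>+\<omega>. ennreal (norm (matrix_inv (gram n \<omega>) - matrix_inv S) powr q) \<partial>M) \<longlonglongrightarrow> 0"
proof (rule tendsto_sandwich[of "\<lambda>_. 0"])
  define k where "k = nat \<lceil>q\<rceil>"
  have k: "0 < k" "q \<le> real k"
    unfolding k_def using q by linarith+
  define D where "D = (real CARD('p))\<^sup>2 / min_rayleigh S"
  have D: "0 \<le> D"
    using min_rayleigh_limit_pos by (simp add: D_def)
  let ?u = "\<lambda>n \<omega>. ennreal (D * deviation n \<omega>) * inverse_min_rayleigh n \<omega>"
  have "(\<integral>\<^sup>+\<omega>. ennreal (norm (matrix_inv (gram n \<omega>) - matrix_inv S) powr q) \<partial>M)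
      \<le> (\<integral>\<^sup>+\<omega>. ?u n \<omega> + ?u n \<omega> ^ k \<partial>M)" for n
    unfolding D_def deviation_def
    by (intro nn_integral_mono matrix_inv_diff_powr_le min_rayleigh_gram_nonneg
        min_rayleigh_limit_pos q k)
  also have "(\<integral>\<^sup>+\<omega>. ?u n \<omega> + ?u n \<omega> ^ k \<partial>M) = (\<integral>\<^sup>+\<omega>. ?u n \<omega> ^ 1 \<partial>M) + (\<integral>\<^sup>+\<omega>. ?u n \<omega> ^ k \<partial>M)" for n
    by (simp add: nn_integral_add)
  finally show "\<forall>\<^sub>F n in sequentially.
      (\<integral>\<^sup>+\<omega>. ennreal (norm (matrix_inv (gram n \<omega>) - matrix_inv S) powr q) \<partial>M)
      \<le> (\<integral>\<^sup>+\<omega>. ?u n \<omega> ^ 1 \<partial>M) + (\<integral>\<^sup>+\<omega>. ?u n \<omega> ^ k \<partial>M)"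
    by simp
  show "(\<lambda>n. (\<integral>\<^sup>+\<omega>. ?u n \<omega> ^ 1 \<partial>M) + (\<integral>\<^sup>+\<omega>. ?u n \<omega> ^ k \<partial>M)) \<longlonglongrightarrow> 0"
    using tendsto_add[OF deviation_inverse_min_rayleigh_tendsto_zero[of 1, OF _ D]
        deviation_inverse_min_rayleigh_tendsto_zero[OF k(1) D]] by simp
qed auto

end

theorem theorem2p6:
  fixes M :: "'a measure"
    and N :: "nat \<Rightarrow> 'a \<Rightarrow> real"
    and B :: "nat \<Rightarrow> nat \<Rightarrow> 'p::finite \<Rightarrow> 'a \<Rightarrow> real"
    and \<Sigma> :: "real^'p^'p"
  assumes "prob_space M"
    and "prob_space.indep_vars M (\<lambda>_. borel) N UNIV"
    and "\<And>i. distributed M lborel (N i) std_normal_density"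
    and "\<And>n i j. i < n \<Longrightarrow> B n i j \<in> first_wiener_chaos M N"
    and "invertible \<Sigma>"
    and "\<And>\<epsilon>. \<epsilon> > 0 \<Longrightarrow>
           (\<lambda>n. measure M {\<omega> \<in> space M. norm (gram_matrix n (\<lambda>i j. B n i j \<omega>) - \<Sigma>) > \<epsilon>})
             \<longlonglongrightarrow> 0"
  shows "(\<forall>q::real. q \<ge> 1 \<longrightarrow>
            (\<exists>N0::nat. \<exists>C::real. C > 0 \<and>
               (\<forall>n\<ge>N0. (\<integral>\<^sup>+\<omega>. (let d = det (gram_matrix n (\<lambda>i j. B n i j \<omega>)) in
                                   if d = 0 then \<infinity> else ennreal (d powr (- q))) \<partial>M)
                         \<le> ennreal C)))
       \<and> (\<forall>q::real. q \<ge> 1 \<longrightarrow>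
            (\<lambda>n. \<integral>\<^sup>+\<omega>. ennreal (norm (matrix_inv (gram_matrix n (\<lambda>i j. B n i j \<omega>))
                                         - matrix_inv \<Sigma>) powr q) \<partial>M) \<longlonglongrightarrow> 0)"
proof -
  interpret prob_space M
    by fact
  interpret convergent_gram M N B \<Sigma>
    using assms by unfold_locales (simp_all add: tendsto_zero_in_prob_def)
  show ?thesis
  proof (intro conjI allI impI)
    fix q :: real assume q: "1 \<le> q"
    obtain C where "0 < C" "\<forall>\<^sub>F n in sequentially.
        (\<integral>\<^sup>+\<omega>. (let d = det (gram n \<omega>) in if d = 0 then \<infinity> else ennreal (d powr (- q))) \<partial>M) \<le> ennreal C"
      using q by (rule inverse_det_moment_bounded)
    then show "\<exists>N0 C. 0 < C \<and> (\<forall>n\<ge>N0. (\<integral>\<^sup>+\<omega>. (let d = det (gram_matrix n (\<lambda>i j. B n i j \<omega>)) in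
        if d = 0 then \<infinity> else ennreal (d powr (- q))) \<partial>M) \<le> ennreal C)"
      unfolding gram_def eventually_sequentially by blast
    show "(\<lambda>n. \<integral>\<^sup>+\<omega>. ennreal (norm (matrix_inv (gram_matrix n (\<lambda>i j. B n i j \<omega>))
        - matrix_inv \<Sigma>) powr q) \<partial>M) \<longlonglongrightarrow> 0"
      using matrix_inv_tendsto_Lq[OF q] by (simp only: gram_def)
  qed
qed

end
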